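(* There exists an absolute constant $c>0$ such that for every integer $n\ge 2$ and every integer $k$ with $0\le k\le \left\lfloor \frac{(n-2)^2}{4}\right\rfloor$ we have $\overline{\max}\, e_k(K_n)\ge c\,n$; that is, there is a rectilinear drawing of the complete graph $K_n$ in which at least $cn$ edges are involved in exactly $k$ crossings.
   Context: All graphs are simple and finite. A rectilinear drawing $\mathcal D$ of a graph represents the vertices by distinct points in the plane in general position (no three collinear) and every edge by the line segment joining its endpoints, with no three edges sharing an interior point. A crossing of $\mathcal D$ is a common interior point of two distinct edges. For an integer $k\ge 0$, $e_k(\mathcal D)$ is the number of edges of $\mathcal D$ that are involved in exactly $k$ crossings. $\overline{\max}\, e_k(G)$ is the maximum of $e_k(\mathcal D)$ over all rectilinear drawings $\mathcal D$ of $G$. *)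

theory Defs
  imports "HOL-Analysis.Analysis"
begin

text \<open>A simple finite graph is given by its vertex set \<open>V\<close> and its set \<open>E\<close> of two-element subsets
  of \<open>V\<close>. A map \<open>p\<close> places the vertices in the plane; only its values on \<open>V\<close> matter.\<close>

definition simple_graph :: "'a set \<Rightarrow> 'a set set \<Rightarrow> bool" where
  "simple_graph V E \<longleftrightarrow> finite V \<and> (\<forall>e\<in>E. e \<subseteq> V \<and> card e = 2)"

definition complete_edges :: "'a set \<Rightarrow> 'a set set" where
  "complete_edges V = {e. e \<subseteq> V \<and> card e = 2}"

definition edge_interior :: "('a \<Rightarrow> real ^ 2) \<Rightarrow> 'a set \<Rightarrow> (real ^ 2) set" where
  "edge_interior p e = {x. \<exists>u v. e = {u, v} \<and> x \<in> open_segment (p u) (p v)}"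

definition rectilinear_drawing ::
  "'a set \<Rightarrow> 'a set set \<Rightarrow> ('a \<Rightarrow> real ^ 2) \<Rightarrow> bool" where
  "rectilinear_drawing V E p \<longleftrightarrow>
     inj_on p V \<and>
     (\<forall>u\<in>V. \<forall>v\<in>V. \<forall>w\<in>V. u \<noteq> v \<and> u \<noteq> w \<and> v \<noteq> w \<longrightarrow> \<not> collinear {p u, p v, p w}) \<and>
     (\<forall>e\<in>E. \<forall>f\<in>E. \<forall>g\<in>E. e \<noteq> f \<and> e \<noteq> g \<and> f \<noteq> g \<longrightarrow>
        edge_interior p e \<inter> edge_interior p f \<inter> edge_interior p g = {})"

definition crossings :: "'a set set \<Rightarrow> ('a \<Rightarrow> real ^ 2) \<Rightarrow> (real ^ 2) set" where
  "crossings E p =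
     {x. \<exists>e\<in>E. \<exists>f\<in>E. e \<noteq> f \<and> x \<in> edge_interior p e \<and> x \<in> edge_interior p f}"

text \<open>In a rectilinear drawing of a finite graph the set of crossings is finite, so that the inner
  cardinality below is never the default value of an infinite set.\<close>

definition e_count :: "nat \<Rightarrow> 'a set set \<Rightarrow> ('a \<Rightarrow> real ^ 2) \<Rightarrow> nat" where
  "e_count k E p = card {e \<in> E. card (crossings E p \<inter> edge_interior p e) = k}"

definition max_e :: "nat \<Rightarrow> 'a set \<Rightarrow> 'a set set \<Rightarrow> nat" where
  "max_e k V E = Max {e_count k E p | p. rectilinear_drawing V E p}"

lemma simple_graph_complete: "finite V \<Longrightarrow> simple_graph V (complete_edges V)"
  by (simp add: simple_graph_def complete_edges_def)

lemma simple_graph_finite_edges: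
  assumes "simple_graph V E"
  shows "finite E"
  by (rule finite_subset[of _ "Pow V"]) (use assms in \<open>auto simp: simple_graph_def\<close>)

text \<open>The set whose maximum is taken is finite, so \<open>max_e\<close> is attained as soon as the graph has
  some rectilinear drawing.\<close>

lemma finite_e_counts:
  assumes "simple_graph V E"
  shows "finite {e_count k E p | p. rectilinear_drawing V E p}"
proof (rule finite_subset)
  show "{e_count k E p | p. rectilinear_drawing V E p} \<subseteq> {..card E}"
    using simple_graph_finite_edges[OF assms] by (auto simp: e_count_def intro!: card_mono)
qed simp

lemma max_e_ge:
  assumes "simple_graph V E" "rectilinear_drawing V E p"
  shows "e_count k E p \<le> max_e k V E"
  unfolding max_e_def by (rule Max_ge[OF finite_e_counts[OF assms(1)]]) (use assms(2) in blast)

lemma max_e_attained: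
  assumes "simple_graph V E" "\<exists>p. rectilinear_drawing V E p"
  obtains p where "rectilinear_drawing V E p" "max_e k V E = e_count k E p"
proof -
  have "max_e k V E \<in> {e_count k E p | p. rectilinear_drawing V E p}"
    unfolding max_e_def by (rule Max_in[OF finite_e_counts[OF assms(1)]]) (use assms(2) in blast)
  then show ?thesis using that by blast
qed

end

theory Submission imports Defs begin

text \<open>Since the crossings at a strict configuration depend only on the orientations of triples, a
  drawing may be described by a degenerate configuration in which the relevant triples are not
  collinear; a small generic perturbation makes it rectilinear.

  Put points \<open>v\<^sub>0, \<dots>, v\<^sub>M\<^sub>-\<^sub>1\<close> on a cap far above a set \<open>Q\<close>. The edge \<open>uv\<^sub>j\<close> is then almost vertical,
  and if it has \<open>\<alpha>\<close> vertices on its left and \<open>\<beta>\<close> on its right, it has \<open>\<alpha>\<beta>\<close> crossings minus the number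
  of segments of \<open>Q\<close> passing below \<open>u\<close>. For \<open>M = 1\<close> this is the number of segments passing above
  \<open>u\<close>. So it suffices to construct sets \<open>Q\<close> in which a positive fraction of the points has exactly
  \<open>r\<close> segments above it, for all \<open>r\<close> up to a constant times \<open>|Q|\<^sup>2\<close>. For small \<open>k\<close> take \<open>M = 1\<close> and
  \<open>r = k\<close>. Otherwise take the most unbalanced \<open>\<alpha> + \<beta> = n - 2\<close> with \<open>\<alpha>\<beta> \<ge> k\<close>, so that \<open>r = \<alpha>\<beta> - k \<le> n\<close>,
  reflect a set \<open>Q\<close> with at most \<open>\<alpha>\<close> points, and join each good \<open>u\<close> to the one \<open>v\<^sub>j\<close> that gives the
  sides the sizes \<open>\<alpha>\<close> and \<open>\<beta>\<close>.

  For \<open>r \<le> |Q| - 2\<close>, hang \<open>r\<close> points on a flat cap slightly below each edge of a large cap: a point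
  \<open>u\<close> on it has above it the edge itself and one segment from an end of the edge to each of the other
  \<open>r - 1\<close> points. Adding \<open>p\<close> high points far to the left and \<open>p\<close> far to the right increases the count
  by the same amount \<open>p(|Q| - 1) + p\<^sup>2\<close> for every point of \<open>Q\<close>.\<close>

section \<open>Orientation of triples of points\<close>

text \<open>Twice the signed area of the triangle: positive exactly when \<open>c\<close> lies to
  the left of the line directed from \<open>a\<close> to \<open>b\<close>.\<close>

definition orient :: "real ^ 2 \<Rightarrow> real ^ 2 \<Rightarrow> real ^ 2 \<Rightarrow> real" where
  "orient a b c = (b$1 - a$1) * (c$2 - a$2) - (b$2 - a$2) * (c$1 - a$1)"

lemma orient_rotate: "orient b c a = orient a b c"
  by (simp add: orient_def algebra_simps)

lemma orient_swap: "orient b a c = - orient a b c"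
  by (simp add: orient_def algebra_simps)

lemma orient_degenerate [simp]: "orient a a c = 0" "orient a b a = 0" "orient a b b = 0"
  by (simp_all add: orient_def algebra_simps)

text \<open>Both sides are the cross product of \<open>d - c\<close> and \<open>b - a\<close>. This
  ties the sides of \<open>ab\<close> on which \<open>c\<close> and \<open>d\<close> lie to the
  sides of \<open>cd\<close> on which \<open>a\<close> and \<open>b\<close> lie.\<close>

lemma orient_diff: "orient c d b - orient c d a = orient a b c - orient a b d"
  by (simp add: orient_def algebra_simps)

lemma orient_affine:
  "orient a b ((1 - t) *\<^sub>R c + t *\<^sub>R d) = (1 - t) * orient a b c + t * orient a b d"
  by (simp add: orient_def algebra_simps)

lemma collinear_iff_orient: "collinear {a, b, c} \<longleftrightarrow> orient a b c = 0"
proof -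
  have eq: "collinear {a, b, c} \<longleftrightarrow> collinear {0, b - a, c - a}"
    using collinear_3[of b a c] by (simp add: insert_commute)
  show ?thesis
  proof (cases "b - a = 0")
    case True
    then show ?thesis by (simp add: orient_def)
  next
    case False
    have "orient a b c = 0 \<longleftrightarrow> (\<exists>t. c - a = t *\<^sub>R (b - a))"
    proof
      assume o: "orient a b c = 0"
      from False have "b$1 - a$1 \<noteq> 0 \<or> b$2 - a$2 \<noteq> 0"
        by (auto simp: vec_eq_iff forall_2)
      then show "\<exists>t. c - a = t *\<^sub>R (b - a)"
      proof
        assume n: "b$1 - a$1 \<noteq> 0"
        define t where "t = (c$1 - a$1) / (b$1 - a$1)"
        have 1: "c$1 - a$1 = t * (b$1 - a$1)" using n by (simp add: t_def)
        have "(b$1 - a$1) * (c$2 - a$2) = (b$1 - a$1) * (t * (b$2 - a$2))"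
          using o 1 by (simp add: orient_def mult.commute)
        then have "c$2 - a$2 = t * (b$2 - a$2)" using n mult_left_cancel by blast
        with 1 show ?thesis by (auto simp: vec_eq_iff forall_2)
      next
        assume n: "b$2 - a$2 \<noteq> 0"
        define t where "t = (c$2 - a$2) / (b$2 - a$2)"
        have 1: "c$2 - a$2 = t * (b$2 - a$2)" using n by (simp add: t_def)
        have "(b$2 - a$2) * (c$1 - a$1) = (b$1 - a$1) * (c$2 - a$2)"
          using o by (simp add: orient_def)
        also have "\<dots> = (b$2 - a$2) * (t * (b$1 - a$1))"
          unfolding 1 by (simp add: mult_ac)
        finally have "(b$2 - a$2) * (c$1 - a$1) = (b$2 - a$2) * (t * (b$1 - a$1))" .
        then have "c$1 - a$1 = t * (b$1 - a$1)" using n mult_left_cancel by blast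
        with 1 show ?thesis by (auto simp: vec_eq_iff forall_2)
      qed
    next
      assume "\<exists>t. c - a = t *\<^sub>R (b - a)"
      then obtain t where t: "c - a = t *\<^sub>R (b - a)" by blast
      have "c$1 - a$1 = t * (b$1 - a$1)" "c$2 - a$2 = t * (b$2 - a$2)"
        using arg_cong[OF t, of "\<lambda>x. x$1"] arg_cong[OF t, of "\<lambda>x. x$2"] by simp_all
      then show "orient a b c = 0" unfolding orient_def by simp
    qed
    also have "\<dots> \<longleftrightarrow> collinear {0, b - a, c - a}"
      using False by (auto simp: collinear_lemma intro: exI[of _ 0])
    finally show ?thesis using eq by simp
  qed
qed

lemma negligible_line:
  assumes "a \<noteq> b"
  shows "negligible {x. orient a b x = 0}"
proof -
  \<comment> \<open>\<open>n\<close> is \<open>b - a\<close> turned by a right angle, so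
    \<open>orient a b\<close> is affine with gradient \<open>n\<close>.\<close>
  define n :: "real ^ 2" where "n = vector [- (b$2 - a$2), b$1 - a$1]"
  have "n \<noteq> 0" using assms by (auto simp: n_def vec_eq_iff forall_2)
  moreover have "orient a b x = n \<bullet> x - n \<bullet> a" for x
    by (simp add: orient_def n_def inner_vec_def sum_2 algebra_simps)
  then have "{x. orient a b x = 0} = {x. n \<bullet> x = n \<bullet> a}" by simp
  ultimately show ?thesis by (simp add: negligible_hyperplane)
qed

section \<open>Crossing of two open segments in terms of orientations\<close>

lemma open_segment_orient:
  assumes "x \<in> open_segment a b"
  obtains t where "0 < t" "t < 1" "x = (1 - t) *\<^sub>R a + t *\<^sub>R b" "a \<noteq> b"
  using assms by (auto simp: in_segment)

text \<open>\<open>orient a b\<close> is affine along \<open>cd\<close> and vanishes at the interior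
  point \<open>x\<close>, so its values at the two ends have opposite signs unless both are
  zero.\<close>

lemma open_segments_meetD:
  assumes x: "x \<in> open_segment a b" "x \<in> open_segment c d"
    and nz: "orient a b c \<noteq> 0 \<or> orient a b d \<noteq> 0"
  shows "orient a b c * orient a b d < 0"
proof -
  obtain t where t: "0 < t" "t < 1" "x = (1 - t) *\<^sub>R a + t *\<^sub>R b"
    using x(1) by (rule open_segment_orient)
  obtain s where s: "0 < s" "s < 1" "x = (1 - s) *\<^sub>R c + s *\<^sub>R d"
    using x(2) by (rule open_segment_orient)
  have "orient a b x = 0" unfolding t(3) by (simp add: orient_affine)
  then have e: "(1 - s) * orient a b c + s * orient a b d = 0"
    unfolding s(3) by (simp add: orient_affine)
  then have "s * orient a b d = - ((1 - s) * orient a b c)" by linarith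
  then have d: "orient a b d = - ((1 - s) / s) * orient a b c"
    using s by (simp add: field_simps)
  with nz have "orient a b c \<noteq> 0" by auto
  then have "orient a b c * orient a b c > 0" by (auto simp: zero_less_mult_iff linorder_neq_iff)
  then have "((1 - s) / s) * (orient a b c * orient a b c) > 0" using s by simp
  then show ?thesis unfolding d by (simp add: algebra_simps)
qed

lemma open_segments_meetI:
  assumes "orient a b c * orient a b d < 0" "orient c d a * orient c d b < 0"
  shows "\<exists>x. x \<in> open_segment a b \<and> x \<in> open_segment c d"
proof -
  \<comment> \<open>The parameters at which \<open>orient c d\<close> vanishes along
    \<open>ab\<close> and \<open>orient a b\<close> vanishes along \<open>cd\<close>.\<close>
  define t where "t = orient c d a / (orient c d a - orient c d b)"
  define s where "s = orient a b c / (orient a b c - orient a b d)"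
  have t: "0 < t" "t < 1" using assms(2) unfolding t_def
    by (auto simp: mult_less_0_iff field_simps)
  have s: "0 < s" "s < 1" using assms(1) unfolding s_def
    by (auto simp: mult_less_0_iff field_simps)
  have ne: "a \<noteq> b" "c \<noteq> d" using assms by auto
  define D where "D = orient a b c - orient a b d"
  have D: "D \<noteq> 0" using assms(1) unfolding D_def by (auto simp: mult_less_0_iff)
  \<comment> \<open>The two denominators agree up to sign, so multiplying by \<open>D\<close> turns
    the equality of the two points into a polynomial identity.\<close>
  have D2: "orient c d a - orient c d b = - D" using orient_diff[of c d b a] unfolding D_def by linarith
  have t': "t = - orient c d a / D" unfolding t_def D2 by simp
  have s': "s = orient a b c / D" unfolding s_def D_def by simp
  have "D * (a$i + t * (b$i - a$i)) = D * (c$i + s * (d$i - c$i))" for i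
  proof -
    have "D * t = - orient c d a" "D * s = orient a b c" using D by (simp_all add: t' s')
    moreover have "D * a$i - orient c d a * (b$i - a$i) = D * c$i + orient a b c * (d$i - c$i)"
      using exhaust_2[of i] by (auto simp: D_def orient_def algebra_simps)
    ultimately show ?thesis by (simp add: distrib_left mult.assoc[symmetric])
  qed
  then have "a$i + t * (b$i - a$i) = c$i + s * (d$i - c$i)" for i using D by simp
  then have "(1 - t) *\<^sub>R a + t *\<^sub>R b = (1 - s) *\<^sub>R c + s *\<^sub>R d"
    by (simp add: vec_eq_iff algebra_simps)
  then show ?thesis using t s ne by (auto simp: in_segment)
qed

lemma orient_same_line:
  assumes "x \<noteq> y" "orient x y a = 0" "orient x y b = 0" "orient x y c = 0"
  shows "orient a b c = 0"
proof -
  have "{a, b, c} \<subseteq> affine hull {x, y}"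
    using assms by (simp add: collinear_iff_orient[symmetric] collinear_3_affine_hull)
  then show ?thesis
    by (auto simp: collinear_iff_orient[symmetric] collinear_affine_hull)
qed

lemma orient_line_trans:
  assumes "x \<noteq> y" "orient a b x = 0" "orient a b y = 0" "orient c d x = 0" "orient c d y = 0" "a \<noteq> b" "c \<noteq> d"
  shows "orient a b c = 0"
proof -
  have "orient x y a = 0" "orient x y b = 0"
    using assms by (auto intro: orient_same_line[of a b])
  moreover have "orient x y c = 0"
    using assms by (auto intro: orient_same_line[of c d])
  ultimately show ?thesis using assms by (auto intro: orient_same_line[of x y])
qed

text \<open>A second common point would make the lines \<open>ab\<close> and \<open>cd\<close>
  coincide, which \<open>nz\<close> forbids.\<close>

lemma open_segments_meet_unique:
  assumes "x \<in> open_segment a b" "x \<in> open_segment c d" "y \<in> open_segment a b" "y \<in> open_segment c d"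
    and nz: "orient a b c \<noteq> 0"
  shows "x = y"
proof (rule ccontr)
  assume "x \<noteq> y"
  have on: "orient a b x = 0 \<and> a \<noteq> b" if "x \<in> open_segment a b" for a b x :: "real ^ 2"
    using that by (metis open_segment_orient orient_affine orient_degenerate(2,3) mult_zero_right add_0)
  show False
    using orient_line_trans[OF \<open>x \<noteq> y\<close>] on assms by metis
qed

section \<open>Generic perturbation\<close>

lemma complete_edges_iff:
  "e \<in> complete_edges V \<longleftrightarrow> (\<exists>u\<in>V. \<exists>v\<in>V. u \<noteq> v \<and> e = {u, v})"
  by (auto simp: complete_edges_def card_2_iff)

lemma finite_complete_edges [simp]: "finite V \<Longrightarrow> finite (complete_edges V)"
  by (metis simple_graph_complete simple_graph_finite_edges)

lemma edge_interior_doubleton [simp]: "edge_interior p {u, v} = open_segment (p u) (p v)"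
  by (auto simp: edge_interior_def doubleton_eq_iff open_segment_commute)

lemma orient_open_segment:
  assumes "x \<in> open_segment a b"
  shows "orient a b x = 0" "a \<noteq> b" "x \<noteq> a" "x \<noteq> b"
proof -
  obtain t where "x = (1 - t) *\<^sub>R a + t *\<^sub>R b" using assms by (rule open_segment_orient)
  then show "orient a b x = 0" by (simp add: orient_affine)
qed (use assms in \<open>auto simp: open_segment_def\<close>)

definition general_position :: "'a set \<Rightarrow> ('a \<Rightarrow> real ^ 2) \<Rightarrow> bool" where
  "general_position V p \<longleftrightarrow> (\<forall>u\<in>V. \<forall>v\<in>V. \<forall>w\<in>V. u \<noteq> v \<and> u \<noteq> w \<and> v \<noteq> w \<longrightarrow> orient (p u) (p v) (p w) \<noteq> 0)"

lemma general_positionD: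
  "general_position V p \<Longrightarrow> u \<in> V \<Longrightarrow> v \<in> V \<Longrightarrow> w \<in> V \<Longrightarrow> u \<noteq> v \<Longrightarrow> u \<noteq> w \<Longrightarrow> v \<noteq> w
    \<Longrightarrow> orient (p u) (p v) (p w) \<noteq> 0"
  unfolding general_position_def by blast

lemma edges_disjoint:
  assumes gp: "general_position V p" and V: "{u, v, w, z} \<subseteq> V"
    and ne: "{u, v} \<noteq> {w, z}" and x: "x \<in> open_segment (p u) (p v)" "x \<in> open_segment (p w) (p z)"
  shows "w \<noteq> u" "w \<noteq> v" "z \<noteq> u" "z \<noteq> v" 
proof -
  have uv: "u \<noteq> v" "w \<noteq> z" using x by (auto dest: orient_open_segment(2))
  have *: False if "{u, v, z} \<subseteq> V" "u \<noteq> v" "u \<noteq> z" "v \<noteq> z" "x \<in> open_segment (p u) (p v)" "x \<in> open_segment (p u) (p z)" for u v z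
  proof -
    have o: "orient (p u) (p v) (p z) \<noteq> 0" using general_positionD[OF gp] that by blast
    \<comment> \<open>With a common end, one factor of the product is the orientation of a triple
      with a repeated point, so the product is zero and not negative.\<close>
    show False using open_segments_meetD[OF that(5,6)] o by simp
  qed
  show "w \<noteq> u" using *[of u v z] uv ne x V by (auto simp: open_segment_commute doubleton_eq_iff)
  show "w \<noteq> v" using *[of v u z] uv ne x V by (auto simp: open_segment_commute doubleton_eq_iff)
  show "z \<noteq> u" using *[of u v w] uv ne x V by (auto simp: open_segment_commute doubleton_eq_iff)
  show "z \<noteq> v" using *[of v u w] uv ne x V by (auto simp: open_segment_commute doubleton_eq_iff)
qed

lemma edge_interiors_meet_unique:
  assumes gp: "general_position V p" and ef: "e \<in> complete_edges V" "f \<in> complete_edges V" "e \<noteq> f"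
    and x: "x \<in> edge_interior p e" "x \<in> edge_interior p f"
    and y: "y \<in> edge_interior p e" "y \<in> edge_interior p f"
  shows "x = y"
proof -
  from ef obtain u v w z where e: "e = {u, v}" "u \<noteq> v" "u \<in> V" "v \<in> V"
    and f: "f = {w, z}" "w \<noteq> z" "w \<in> V" "z \<in> V" by (auto simp: complete_edges_iff)
  have "w \<noteq> u" "w \<noteq> v"
    using edges_disjoint[OF gp, of u v w z x] ef e f x by auto
  then have "orient (p u) (p v) (p w) \<noteq> 0" using general_positionD[OF gp] e f by metis
  then show ?thesis
    using open_segments_meet_unique[of x "p u" "p v" "p w" "p z" y] x y e f by simp
qed

lemma crossingsI:
  "e \<in> E \<Longrightarrow> f \<in> E \<Longrightarrow> e \<noteq> f \<Longrightarrow> x \<in> edge_interior p e \<Longrightarrow> x \<in> edge_interior p f \<Longrightarrow> x \<in> crossings E p"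
  unfolding crossings_def by blast

lemma finite_crossings:
  assumes gp: "general_position V p" and fin: "finite V"
  shows "finite (crossings (complete_edges V) p)"
proof -
  let ?E = "complete_edges V"
  let ?I = "\<lambda>(e, f). if e \<noteq> f then edge_interior p e \<inter> edge_interior p f else {}"
  have "crossings ?E p \<subseteq> (\<Union>ef\<in>?E \<times> ?E. ?I ef)"
    by (force simp: crossings_def)
  moreover have "finite (?I ef)" if ef: "ef \<in> ?E \<times> ?E" for ef
  proof (cases "?I ef = {}")
    case False
    then obtain x where x: "x \<in> ?I ef" by blast
    obtain e f where [simp]: "ef = (e, f)" by (cases ef)
    have "?I ef \<subseteq> {x}"
      using edge_interiors_meet_unique[OF gp, of e f] x ef by (auto split: if_splits)
    then show ?thesis by (rule finite_subset) simp
  qed simp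
  ultimately show ?thesis using fin by (auto intro: finite_subset)
qed

lemma rectilinear_drawing_general_position:
  "rectilinear_drawing V E p \<Longrightarrow> general_position V p"
  by (auto simp: rectilinear_drawing_def general_position_def collinear_iff_orient)

lemma rectilinear_drawing_no_triple:
  assumes "rectilinear_drawing V E p" "e \<in> E" "f \<in> E" "g \<in> E" "e \<noteq> f" "e \<noteq> g" "f \<noteq> g"
    and c: "c \<in> edge_interior p e" "c \<in> edge_interior p f" "c \<in> edge_interior p g"
  shows False
proof -
  have "\<forall>e\<in>E. \<forall>f\<in>E. \<forall>g\<in>E. e \<noteq> f \<and> e \<noteq> g \<and> f \<noteq> g \<longrightarrow>
      edge_interior p e \<inter> edge_interior p f \<inter> edge_interior p g = {}"
    using assms(1) by (simp add: rectilinear_drawing_def)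
  from this[rule_format, OF assms(2-4)] show False using assms(5-7) c by auto
qed

lemma ball_avoids_negligible:
  fixes P :: "real ^ 2"
  assumes "negligible S" "0 < \<epsilon>"
  obtains x where "dist x P < \<epsilon>" "x \<notin> S"
proof -
  have "\<not> ball P \<epsilon> \<subseteq> S"
    using assms negligible_subset open_not_negligible[of "ball P \<epsilon>"] by auto
  then obtain x where "x \<in> ball P \<epsilon>" "x \<notin> S" by blast
  then have "dist x P < \<epsilon>" "x \<notin> S" by (simp_all add: dist_commute)
  then show ?thesis using that by blast
qed

text \<open>The new vertex only has to avoid finitely many points and lines: the lines through two old
  vertices, and the lines joining an old vertex to an old crossing.\<close>
lemma rectilinear_drawing_insert:
  assumes d: "rectilinear_drawing V (complete_edges V) p" and fin: "finite V" and n: "n \<notin> V" and e: "0 < \<epsilon>"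
  obtains x where "dist x P < \<epsilon>" "rectilinear_drawing (insert n V) (complete_edges (insert n V)) (p(n := x))"
proof -
  let ?E = "complete_edges V" and ?E' = "complete_edges (insert n V)"
  have gp: "general_position V p" by (rule rectilinear_drawing_general_position[OF d])
  \<comment> \<open>For \<open>a = b\<close> the orientation vanishes on the whole plane, hence the
    empty set instead.\<close>
  define L where "L = (\<lambda>(a :: real ^ 2, b). if a = b then {} else {x. orient a b x = 0})"
  define C where "C = p ` V \<union> crossings ?E p"
  define B where "B = p ` V \<union> (\<Union>ab\<in>p ` V \<times> C. L ab)"
  have "finite C" unfolding C_def using finite_crossings[OF gp fin] fin by simp
  moreover have "negligible (L ab)" for ab
    by (cases ab) (simp add: L_def negligible_line)
  ultimately have "negligible (\<Union>ab\<in>p ` V \<times> C. L ab)"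
    using fin by (intro negligible_Union) auto
  then have "negligible B" unfolding B_def using fin
    by (intro negligible_Un) (auto intro: negligible_finite)
  then obtain x where x: "dist x P < \<epsilon>" "x \<notin> B" using e by (rule ball_avoids_negligible)
  have xp: "x \<noteq> p i" if "i \<in> V" for i using x(2) that by (auto simp: B_def)
  have xl: "orient (p i) c x \<noteq> 0" if "i \<in> V" "c \<in> C" "p i \<noteq> c" for i c
  proof -
    have "x \<notin> L (p i, c)" using x(2) that unfolding B_def by blast
    then show ?thesis using that(3) by (simp add: L_def)
  qed
  have inj: "inj_on p V" using d by (simp add: rectilinear_drawing_def)
  have xo: "orient (p i) (p j) x \<noteq> 0" if "i \<in> V" "j \<in> V" "i \<noteq> j" for i j
    using xl[of i "p j"] that inj by (auto simp: C_def inj_on_def)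
  let ?q = "p(n := x)"
  have gp': "general_position (insert n V) ?q"
    unfolding general_position_def
  proof (intro ballI impI)
    fix u v w assume uvw: "u \<in> insert n V" "v \<in> insert n V" "w \<in> insert n V" "u \<noteq> v \<and> u \<noteq> w \<and> v \<noteq> w"
    consider "u = n" | "v = n" | "w = n" | "u \<noteq> n" "v \<noteq> n" "w \<noteq> n" by blast
    then show "orient (?q u) (?q v) (?q w) \<noteq> 0"
    proof cases
      case 1
      then show ?thesis using uvw xo[of v w] by (auto simp: orient_rotate[of "p v" "p w" x, symmetric])
    next
      case 2
      then show ?thesis using uvw xo[of w u] by (auto simp: orient_rotate[of "p u" x "p w"])
    next
      case 3
      then show ?thesis using uvw xo[of u v] by auto
    next
      case 4
      then show ?thesis using uvw general_positionD[OF gp, of u v w] by auto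
    qed
  qed
  have old: "e \<in> ?E \<and> edge_interior ?q e = edge_interior p e" if "e \<in> ?E'" "n \<notin> e" for e
  proof -
    from that obtain u v where "e = {u, v}" "u \<noteq> v" "u \<in> V" "v \<in> V" by (auto simp: complete_edges_iff)
    then show ?thesis using that by (auto simp: complete_edges_iff)
  qed
  have new: "\<exists>i\<in>V. e = {n, i} \<and> edge_interior ?q e = open_segment x (p i)" if "e \<in> ?E'" "n \<in> e" for e
  proof -
    from that obtain i where "e = {n, i}" "n \<noteq> i" "i \<in> V" by (auto simp: complete_edges_iff insert_commute)
    then show ?thesis by auto
  qed
  \<comment> \<open>Two new edges share the vertex \<open>n\<close>, and edges with a common end do
    not cross.\<close>
  have two: False if efg: "e \<in> ?E'" "f \<in> ?E'" "e \<noteq> f" "n \<in> e" "n \<in> f"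
    and c: "c \<in> edge_interior ?q e" "c \<in> edge_interior ?q f" for e f c
  proof -
    obtain i where i: "i \<in> V" "e = {n, i}" using new[of e] efg by blast
    obtain j where j: "j \<in> V" "f = {n, j}" using new[of f] efg by blast
    have "{n, i, n, j} \<subseteq> insert n V" "{n, i} \<noteq> {n, j}"
      "c \<in> open_segment (?q n) (?q i)" "c \<in> open_segment (?q n) (?q j)"
      using c efg(3) i j unfolding i(2) j(2) edge_interior_doubleton by auto
    then show False using edges_disjoint(1)[OF gp', of n i n j c] by blast
  qed
  \<comment> \<open>If a new edge passed through a crossing \<open>c\<close> of two old ones,
    \<open>x\<close> would lie on the line through \<open>c\<close> and an old vertex, which
    \<open>B\<close> excludes.\<close>
  have one: False if efg: "e \<in> ?E'" "f \<in> ?E'" "g \<in> ?E'" "f \<noteq> g" "n \<in> e" "n \<notin> f" "n \<notin> g"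
    and c: "c \<in> edge_interior ?q e" "c \<in> edge_interior ?q f" "c \<in> edge_interior ?q g" for e f g c
  proof -
    obtain i where i: "i \<in> V" "e = {n, i}" and eq: "edge_interior ?q e = open_segment x (p i)"
      using new[OF efg(1,5)] by blast
    have ci: "c \<in> open_segment x (p i)" using c(1) unfolding eq .
    have "f \<in> ?E" "g \<in> ?E" "c \<in> edge_interior p f" "c \<in> edge_interior p g"
      using old[OF efg(2,6)] old[OF efg(3,7)] c(2,3) by simp_all
    then have "c \<in> C" using crossingsI[of f ?E g c p] efg(4) unfolding C_def by simp
    moreover have "c \<noteq> p i" "orient x (p i) c = 0" using orient_open_segment[OF ci] by auto
    ultimately show False using xl[OF i(1)] orient_rotate[of "p i" c x] by auto
  qed
  have "rectilinear_drawing (insert n V) ?E' ?q"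
    unfolding rectilinear_drawing_def
  proof (intro conjI ballI impI)
    show "inj_on ?q (insert n V)" using inj xp n by (auto simp: inj_on_def)
    fix u v w assume "u \<in> insert n V" "v \<in> insert n V" "w \<in> insert n V" "u \<noteq> v \<and> u \<noteq> w \<and> v \<noteq> w"
    then show "\<not> collinear {?q u, ?q v, ?q w}"
      using general_positionD[OF gp', of u v w] by (simp add: collinear_iff_orient)
  next
    fix e f g assume efg: "e \<in> ?E'" "f \<in> ?E'" "g \<in> ?E'" "e \<noteq> f \<and> e \<noteq> g \<and> f \<noteq> g"
    show "edge_interior ?q e \<inter> edge_interior ?q f \<inter> edge_interior ?q g = {}"
    proof (rule ccontr)
      assume "\<not> ?thesis"
      then obtain c where c: "c \<in> edge_interior ?q e" "c \<in> edge_interior ?q f" "c \<in> edge_interior ?q g" by blast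
      have ne: "e \<noteq> f" "e \<noteq> g" "f \<noteq> g" using efg(4) by auto
      have t: "\<not> (n \<in> e \<and> n \<in> f)" "\<not> (n \<in> e \<and> n \<in> g)" "\<not> (n \<in> f \<and> n \<in> g)"
        using two[OF efg(1,2) ne(1) _ _ c(1,2)] two[OF efg(1,3) ne(2) _ _ c(1,3)]
          two[OF efg(2,3) ne(3) _ _ c(2,3)] by auto
      have n: "n \<notin> e" "n \<notin> f" "n \<notin> g"
        using one[OF efg(1,2,3) ne(3) _ _ _ c] one[OF efg(2,1,3) ne(2) _ _ _ c(2,1,3)]
          one[OF efg(3,1,2) ne(1) _ _ _ c(3,1,2)] t by auto
      have "e \<in> ?E" "f \<in> ?E" "g \<in> ?E" "c \<in> edge_interior p e" "c \<in> edge_interior p f" "c \<in> edge_interior p g"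
        using old[OF efg(1) n(1)] old[OF efg(2) n(2)] old[OF efg(3) n(3)] c by auto
      then show False using rectilinear_drawing_no_triple[OF d _ _ _ ne] by simp
    qed
  qed
  with x(1) show ?thesis using that by blast
qed

text \<open>Induction on the vertices, each placed within \<open>\<epsilon>\<close> of its target;
  the targets may coincide or be collinear.\<close>

lemma rectilinear_drawing_near:
  assumes "finite V" "0 < \<epsilon>"
  shows "\<exists>p. rectilinear_drawing V (complete_edges V) p \<and> (\<forall>i\<in>V. dist (p i) (P i) < \<epsilon>)"
  using assms(1)
proof (induction rule: finite_induct)
  case empty
  show ?case by (auto simp: rectilinear_drawing_def complete_edges_def)
next
  case (insert n V)
  then obtain p where p: "rectilinear_drawing V (complete_edges V) p" "\<forall>i\<in>V. dist (p i) (P i) < \<epsilon>" by blast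
  obtain x where "dist x (P n) < \<epsilon>" "rectilinear_drawing (insert n V) (complete_edges (insert n V)) (p(n := x))"
    using rectilinear_drawing_insert[OF p(1) insert.hyps assms(2)] .
  moreover from calculation have "\<forall>i\<in>insert n V. dist ((p(n := x)) i) (P i) < \<epsilon>"
    using p(2) insert.hyps by auto
  ultimately show ?case by blast
qed

text \<open>By continuity a nonzero orientation keeps its sign under small moves, and finitely many
  triples share one bound.\<close>

lemma orient_sgn_stable:
  assumes "finite V"
  shows "\<exists>\<epsilon>>0. \<forall>p. (\<forall>i\<in>V. dist (p i) (P i) < \<epsilon>) \<longrightarrow>
    (\<forall>i\<in>V. \<forall>j\<in>V. \<forall>k\<in>V. orient (P i) (P j) (P k) \<noteq> 0 \<longrightarrow> sgn (orient (p i) (p j) (p k)) = sgn (orient (P i) (P j) (P k)))"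
proof -
  have dist_Pair: "dist (x, y) (x', y') \<le> dist x x' + dist y y'"
    for x x' :: "'b :: metric_space" and y y' :: "'c :: metric_space"
    by (simp add: dist_prod_def sqrt_sum_squares_le_sum)
  have 1: "\<exists>d>0. \<forall>a' b' c'. dist a' a < d \<longrightarrow> dist b' b < d \<longrightarrow> dist c' c < d \<longrightarrow> sgn (orient a' b' c') = sgn (orient a b c)"
    if nz: "orient a b c \<noteq> 0" for a b c
  proof -
    let ?S = "{x :: (real^2) \<times> (real^2) \<times> (real^2). 0 < orient a b c * orient (fst x) (fst (snd x)) (snd (snd x))}"
    have "open ?S"
      unfolding orient_def by (intro open_Collect_less continuous_intros)
    moreover have "(a, b, c) \<in> ?S" using nz by (auto simp: zero_less_mult_iff)
    ultimately obtain e where e: "e > 0" "ball (a, b, c) e \<subseteq> ?S" by (meson openE)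
    have "sgn (orient a' b' c') = sgn (orient a b c)"
      if d: "dist a' a < e / 3" "dist b' b < e / 3" "dist c' c < e / 3" for a' b' c'
    proof -
      have "dist (a, b, c) (a', b', c') \<le> dist a a' + dist (b, c) (b', c')"
        by (rule dist_Pair)
      also have "dist (b, c) (b', c') \<le> dist b b' + dist c c'"
        by (rule dist_Pair)
      finally have "dist (a, b, c) (a', b', c') < e" using d by (simp add: dist_commute)
      then have "(a', b', c') \<in> ?S" using e(2) by auto
      then show ?thesis by (auto simp: zero_less_mult_iff sgn_if)
    qed
    moreover have "0 < e / 3" using e(1) by simp
    ultimately show ?thesis by blast
  qed
  define ok where "ok = (\<lambda>d (i, j, k). \<forall>a' b' c'. dist a' (P i) < d \<longrightarrow> dist b' (P j) < d \<longrightarrow> dist c' (P k) < d \<longrightarrow>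
    orient (P i) (P j) (P k) \<noteq> 0 \<longrightarrow> sgn (orient a' b' c') = sgn (orient (P i) (P j) (P k)))"
  have "\<forall>\<^sub>F d in at_right (0::real). \<forall>t\<in>V \<times> V \<times> V. ok d t"
  proof (rule eventually_ball_finite)
    show "\<forall>t\<in>V \<times> V \<times> V. \<forall>\<^sub>F d in at_right 0. ok d t"
    proof (clarify)
      fix i j k
      show "\<forall>\<^sub>F d in at_right 0. ok d (i, j, k)"
      proof (cases "orient (P i) (P j) (P k) = 0")
        case False
        from 1[OF this] obtain d where d: "d > 0" "\<forall>a' b' c'. dist a' (P i) < d \<longrightarrow> dist b' (P j) < d \<longrightarrow> dist c' (P k) < d \<longrightarrow>
          sgn (orient a' b' c') = sgn (orient (P i) (P j) (P k))" by blast
        have "ok d' (i, j, k)" if "d' < d" for d'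
          unfolding ok_def prod.case using d(2) less_trans[OF _ that] by blast
        then show ?thesis using d(1) unfolding eventually_at_right_field by blast
      qed (simp add: ok_def)
    qed
  qed (use assms in simp)
  then obtain b where b: "b > 0" "\<forall>d>0. d < b \<longrightarrow> (\<forall>t\<in>V \<times> V \<times> V. ok d t)"
    unfolding eventually_at_right_field by auto
  \<comment> \<open>Half of \<open>b\<close>, as the bound is only known strictly below
    \<open>b\<close>.\<close>
  have "ok (b / 2) (i, j, k)" if "i \<in> V" "j \<in> V" "k \<in> V" for i j k using b that by simp
  then have "\<forall>p. (\<forall>i\<in>V. dist (p i) (P i) < b / 2) \<longrightarrow>
    (\<forall>i\<in>V. \<forall>j\<in>V. \<forall>k\<in>V. orient (P i) (P j) (P k) \<noteq> 0 \<longrightarrow> sgn (orient (p i) (p j) (p k)) = sgn (orient (P i) (P j) (P k)))"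
    unfolding ok_def prod.case by blast
  moreover have "0 < b / 2" using b(1) by simp
  ultimately show ?thesis by blast
qed

text \<open>Moving the vertices by less than the stability bound is what turns a degenerate
  configuration into a drawing.\<close>

lemma rectilinear_drawing_orient:
  assumes "finite V"
  obtains p where "rectilinear_drawing V (complete_edges V) p"
    "\<And>i j k. i \<in> V \<Longrightarrow> j \<in> V \<Longrightarrow> k \<in> V \<Longrightarrow> orient (P i) (P j) (P k) \<noteq> 0
      \<Longrightarrow> sgn (orient (p i) (p j) (p k)) = sgn (orient (P i) (P j) (P k))"
proof -
  obtain \<epsilon> where e: "\<epsilon> > 0" "\<forall>p. (\<forall>i\<in>V. dist (p i) (P i) < \<epsilon>) \<longrightarrow>
    (\<forall>i\<in>V. \<forall>j\<in>V. \<forall>k\<in>V. orient (P i) (P j) (P k) \<noteq> 0 \<longrightarrow> sgn (orient (p i) (p j) (p k)) = sgn (orient (P i) (P j) (P k)))"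
    using orient_sgn_stable[OF assms, of P] by blast
  obtain p where "rectilinear_drawing V (complete_edges V) p" "\<forall>i\<in>V. dist (p i) (P i) < \<epsilon>"
    using rectilinear_drawing_near[OF assms e(1), of P] by blast
  then show ?thesis using e(2) that by blast
qed

section \<open>Counting the crossings of an edge\<close>

text \<open>If \<open>y\<close> lies to the left and \<open>z\<close> to the right of the line \<open>uv\<close>, then the line \<open>yz\<close> separates
  \<open>u\<close> from \<open>v\<close> only with \<open>u\<close> on its right and \<open>v\<close> on its left.\<close>
definition crossing_pairs :: "'a set \<Rightarrow> ('a \<Rightarrow> real ^ 2) \<Rightarrow> 'a \<Rightarrow> 'a \<Rightarrow> ('a \<times> 'a) set" where
  "crossing_pairs V p u v = {(y, z) \<in> V \<times> V.
     orient (p u) (p v) (p y) > 0 \<and> orient (p u) (p v) (p z) < 0 \<and>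
     orient (p y) (p z) (p u) < 0 \<and> orient (p y) (p z) (p v) > 0}"

text \<open>Since no three edges share a point, a crossing on the edge determines the other edge
  through it; naming the left end of that edge first makes the correspondence with pairs
  bijective.\<close>

lemma card_crossings_edge:
  assumes d: "rectilinear_drawing V (complete_edges V) p" and uv: "u \<in> V" "v \<in> V" "u \<noteq> v"
  shows "card (crossings (complete_edges V) p \<inter> edge_interior p {u, v}) = card (crossing_pairs V p u v)"
proof -
  let ?E = "complete_edges V" and ?S = "crossing_pairs V p u v"
  let ?T = "crossings ?E p \<inter> edge_interior p {u, v}"
  have gp: "general_position V p" by (rule rectilinear_drawing_general_position[OF d])
  define f where "f = (\<lambda>(y, z). SOME x. x \<in> open_segment (p u) (p v) \<and> x \<in> open_segment (p y) (p z))"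
  have S: "y \<in> V" "z \<in> V" "y \<noteq> z" "{y, z} \<noteq> {u, v}" "orient (p u) (p v) (p y) > 0" "orient (p u) (p v) (p z) < 0"
    "f (y, z) \<in> edge_interior p {u, v}" "f (y, z) \<in> edge_interior p {y, z}"
    if yz: "(y, z) \<in> ?S" for y z
  proof -
    show *: "y \<in> V" "z \<in> V" "y \<noteq> z" "orient (p u) (p v) (p y) > 0" "orient (p u) (p v) (p z) < 0"
      using yz by (auto simp: crossing_pairs_def)
    then have "y \<noteq> u" "y \<noteq> v" by auto
    then show "{y, z} \<noteq> {u, v}" by auto
    have "\<exists>x. x \<in> open_segment (p u) (p v) \<and> x \<in> open_segment (p y) (p z)"
      using yz by (intro open_segments_meetI) (auto simp: crossing_pairs_def mult_less_0_iff)
    from someI_ex[OF this] show "f (y, z) \<in> edge_interior p {u, v}" "f (y, z) \<in> edge_interior p {y, z}"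
      by (auto simp: f_def)
  qed
  have uvE: "{u, v} \<in> ?E" using uv by (auto simp: complete_edges_iff)
  have E: "{y, z} \<in> ?E" if "(y, z) \<in> ?S" for y z
    using S[OF that] by (auto simp: complete_edges_iff)
  have "bij_betw f ?S ?T"
    unfolding bij_betw_def
  proof
    show "inj_on f ?S"
    proof (rule inj_onI, clarify)
      fix y z y' z' assume s: "(y, z) \<in> ?S" "(y', z') \<in> ?S" and eq: "f (y, z) = f (y', z')"
      have "{y, z} = {y', z'}"
      proof (rule ccontr)
        assume ne: "{y, z} \<noteq> {y', z'}"
        show False
          by (rule rectilinear_drawing_no_triple[OF d uvE E[OF s(1)] E[OF s(2)]
                S(4)[OF s(1), symmetric] S(4)[OF s(2), symmetric] ne S(7,8)[OF s(1)] S(8)[OF s(2), folded eq]])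
      qed
      then show "y = y' \<and> z = z'"
        using S(5,6)[OF s(1)] S(5,6)[OF s(2)] by (auto simp: doubleton_eq_iff)
    qed
    show "f ` ?S = ?T"
    proof
      show "f ` ?S \<subseteq> ?T"
      proof (rule image_subsetI)
        fix s assume "s \<in> ?S"
        moreover obtain y z where "s = (y, z)" by (cases s)
        ultimately have yz: "(y, z) \<in> ?S" "s = (y, z)" by auto
        have "f (y, z) \<in> crossings ?E p"
          by (rule crossingsI[OF E[OF yz(1)] uvE S(4)[OF yz(1)] S(8)[OF yz(1)] S(7)[OF yz(1)]])
        then show "f s \<in> ?T" using S(7)[OF yz(1)] yz(2) by blast
      qed
      show "?T \<subseteq> f ` ?S"
      proof
        fix x assume x: "x \<in> ?T"
        then obtain g where g: "g \<in> ?E" "g \<noteq> {u, v}" "x \<in> edge_interior p g"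
          unfolding crossings_def by blast
        then obtain w z where wz: "g = {w, z}" "w \<noteq> z" "w \<in> V" "z \<in> V" by (auto simp: complete_edges_iff)
        have xs: "x \<in> open_segment (p u) (p v)" "x \<in> open_segment (p w) (p z)"
          using x g wz by auto
        have ne: "w \<noteq> u" "w \<noteq> v" "z \<noteq> u" "z \<noteq> v"
          using edges_disjoint[OF gp, of u v w z x] uv wz g(2) xs by auto
        have 1: "orient (p u) (p v) (p w) * orient (p u) (p v) (p z) < 0"
          using open_segments_meetD[OF xs] general_positionD[OF gp, of u v w] uv wz ne by auto
        have 2: "orient (p w) (p z) (p u) * orient (p w) (p z) (p v) < 0"
          using open_segments_meetD[OF xs(2,1)] general_positionD[OF gp, of w z u] uv wz ne by auto
        \<comment> \<open>If \<open>w\<close> is on the left and \<open>z\<close> on the right, this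
          difference is positive, so of the two opposite signs in \<open>2\<close> the negative one
          belongs to \<open>u\<close>.\<close>
        have 3: "orient (p w) (p z) (p v) - orient (p w) (p z) (p u) = orient (p u) (p v) (p w) - orient (p u) (p v) (p z)"
          by (rule orient_diff)
        have "\<exists>yz\<in>?S. {fst yz, snd yz} = g"
        proof (cases "orient (p u) (p v) (p w) > 0")
          case True
          then have "(w, z) \<in> ?S" using 1 2 3 wz by (auto simp: crossing_pairs_def mult_less_0_iff)
          then show ?thesis using wz by force
        next
          case False
          then have "(z, w) \<in> ?S" using 1 2 3 wz orient_swap[of "p w" "p z"]
            by (auto simp: crossing_pairs_def mult_less_0_iff)
          then show ?thesis using wz by force
        qed
        then obtain y' z' where s: "(y', z') \<in> ?S" "{y', z'} = g" by auto
        have "f (y', z') = x"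
          using edge_interiors_meet_unique[OF gp uvE E[OF s(1)]] S(4,7,8)[OF s(1)] x g s by auto
        then show "x \<in> f ` ?S" using s by blast
      qed
    qed
  qed
  then show ?thesis by (simp add: bij_betw_same_card)
qed

text \<open>Noncollinearity is asked only of the triples whose sign \<open>crossing_pairs\<close>
  tests, so that \<open>P\<close> may be degenerate elsewhere.\<close>

definition strict_edge :: "'a set \<Rightarrow> ('a \<Rightarrow> real ^ 2) \<Rightarrow> 'a \<Rightarrow> 'a \<Rightarrow> bool" where
  "strict_edge V P u v \<longleftrightarrow>
     (\<forall>y\<in>V - {u, v}. orient (P u) (P v) (P y) \<noteq> 0) \<and>
     (\<forall>y\<in>V. \<forall>z\<in>V. orient (P u) (P v) (P y) > 0 \<and> orient (P u) (P v) (P z) < 0 \<longrightarrow>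
        orient (P y) (P z) (P u) \<noteq> 0 \<and> orient (P y) (P z) (P v) \<noteq> 0)"

lemma sgn_eq_iff_real:
  fixes a b :: real
  assumes "sgn a = sgn b"
  shows "a < 0 \<longleftrightarrow> b < 0" "a > 0 \<longleftrightarrow> b > 0"
  using assms by (auto simp: sgn_if split: if_splits)

text \<open>A sign tested for membership is either nonzero at \<open>P\<close> by strictness, hence
  kept, or zero in both configurations because a vertex is repeated.\<close>

lemma crossing_pairs_transfer:
  assumes s: "strict_edge V P u v" and uv: "u \<in> V" "v \<in> V"
    and p: "\<And>i j k. i \<in> V \<Longrightarrow> j \<in> V \<Longrightarrow> k \<in> V \<Longrightarrow> orient (P i) (P j) (P k) \<noteq> 0
      \<Longrightarrow> sgn (orient (p i) (p j) (p k)) = sgn (orient (P i) (P j) (P k))"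
  shows "crossing_pairs V p u v = crossing_pairs V P u v"
proof -
  have 1: "sgn (orient (p u) (p v) (p y)) = sgn (orient (P u) (P v) (P y))" if "y \<in> V" for y
  proof (cases "y = u \<or> y = v")
    case False
    then show ?thesis using p[OF uv that] s that by (auto simp: strict_edge_def)
  qed auto
  have 2: "sgn (orient (p y) (p z) (p u)) = sgn (orient (P y) (P z) (P u))"
    "sgn (orient (p y) (p z) (p v)) = sgn (orient (P y) (P z) (P v))"
    if "y \<in> V" "z \<in> V" "orient (P u) (P v) (P y) > 0 \<and> orient (P u) (P v) (P z) < 0" for y z
    using p[OF that(1,2)] that uv s unfolding strict_edge_def by auto
  have "(y, z) \<in> crossing_pairs V p u v \<longleftrightarrow> (y, z) \<in> crossing_pairs V P u v" for y z
  proof (cases "y \<in> V \<and> z \<in> V \<and> orient (P u) (P v) (P y) > 0 \<and> orient (P u) (P v) (P z) < 0")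
    case True
    then have "y \<in> V" "z \<in> V" "orient (P u) (P v) (P y) > 0 \<and> orient (P u) (P v) (P z) < 0" by auto
    note 2 = 2[OF this] and 1 = 1[OF this(1)] 1[OF this(2)]
    show ?thesis
      using sgn_eq_iff_real[OF 2(1)] sgn_eq_iff_real[OF 2(2)] sgn_eq_iff_real[OF 1(1)] sgn_eq_iff_real[OF 1(2)]
      by (simp add: crossing_pairs_def)
  next
    case False
    then show ?thesis
      using sgn_eq_iff_real[OF 1[of y]] sgn_eq_iff_real[OF 1[of z]]
      by (auto simp: crossing_pairs_def)
  qed
  then show ?thesis by auto
qed

text \<open>Reduces the problem to a possibly degenerate \<open>P\<close>: a single perturbation
  serves all edges in \<open>F\<close> at once.\<close>

lemma exists_drawing_e_count:
  assumes fin: "finite V"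
    and F: "\<And>e. e \<in> F \<Longrightarrow> \<exists>u\<in>V. \<exists>v\<in>V. u \<noteq> v \<and> e = {u, v} \<and> strict_edge V P u v \<and> card (crossing_pairs V P u v) = k"
  shows "\<exists>p. rectilinear_drawing V (complete_edges V) p \<and> card F \<le> e_count k (complete_edges V) p"
proof -
  obtain p where d: "rectilinear_drawing V (complete_edges V) p"
    and p: "\<And>i j k. i \<in> V \<Longrightarrow> j \<in> V \<Longrightarrow> k \<in> V \<Longrightarrow> orient (P i) (P j) (P k) \<noteq> 0
      \<Longrightarrow> sgn (orient (p i) (p j) (p k)) = sgn (orient (P i) (P j) (P k))"
    using rectilinear_drawing_orient[OF fin, of P] by metis
  have "F \<subseteq> {e \<in> complete_edges V. card (crossings (complete_edges V) p \<inter> edge_interior p e) = k}"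
  proof
    fix e assume "e \<in> F"
    from F[OF this] obtain u v where uv: "u \<in> V" "v \<in> V" "u \<noteq> v" "e = {u, v}"
      and s: "strict_edge V P u v" "card (crossing_pairs V P u v) = k" by blast
    have cp: "crossing_pairs V p u v = crossing_pairs V P u v"
      by (rule crossing_pairs_transfer[OF s(1) uv(1,2)]) (rule p)
    have "card (crossings (complete_edges V) p \<inter> edge_interior p e) = k"
      using card_crossings_edge[OF d uv(1-3)] cp s(2) uv(4) by simp
    then show "e \<in> {e \<in> complete_edges V. card (crossings (complete_edges V) p \<inter> edge_interior p e) = k}"
      using uv by (auto simp: complete_edges_iff)
  qed
  then have "card F \<le> e_count k (complete_edges V) p"
    unfolding e_count_def using fin by (intro card_mono) auto
  then show ?thesis using d by blast
qed

section \<open>A distant cap\<close>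

definition left_of :: "nat \<Rightarrow> (nat \<Rightarrow> real ^ 2) \<Rightarrow> nat \<Rightarrow> nat set" where
  "left_of N Q u = {a. a < N \<and> Q a $ 1 < Q u $ 1}"

definition right_of :: "nat \<Rightarrow> (nat \<Rightarrow> real ^ 2) \<Rightarrow> nat \<Rightarrow> nat set" where
  "right_of N Q u = {b. b < N \<and> Q u $ 1 < Q b $ 1}"

text \<open>As \<open>a\<close> is to the left of \<open>b\<close>, a negative orientation puts
  \<open>Q u\<close> below the segment; "above" describes the segment, not its ends.\<close>

definition above_pairs :: "nat \<Rightarrow> (nat \<Rightarrow> real ^ 2) \<Rightarrow> nat \<Rightarrow> (nat \<times> nat) set" where
  "above_pairs N Q u = {(a, b) \<in> left_of N Q u \<times> right_of N Q u. orient (Q a) (Q b) (Q u) < 0}"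

definition below_pairs :: "nat \<Rightarrow> (nat \<Rightarrow> real ^ 2) \<Rightarrow> nat \<Rightarrow> (nat \<times> nat) set" where
  "below_pairs N Q u = {(a, b) \<in> left_of N Q u \<times> right_of N Q u. orient (Q a) (Q b) (Q u) > 0}"

definition strict_at :: "nat \<Rightarrow> (nat \<Rightarrow> real ^ 2) \<Rightarrow> nat \<Rightarrow> bool" where
  "strict_at N Q u \<longleftrightarrow> u < N \<and> (\<forall>i<N. i \<noteq> u \<longrightarrow> Q i $ 1 \<noteq> Q u $ 1) \<and>
     (\<forall>a\<in>left_of N Q u. \<forall>b\<in>right_of N Q u. orient (Q a) (Q b) (Q u) \<noteq> 0)"

lemma finite_left_right [simp]: "finite (left_of N Q u)" "finite (right_of N Q u)"
  by (auto simp: left_of_def right_of_def)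

lemma card_left_right:
  assumes "strict_at N Q u"
  shows "card (left_of N Q u) + card (right_of N Q u) = N - 1"
proof -
  have "left_of N Q u \<union> right_of N Q u = {..<N} - {u}"
    using assms by (auto simp: left_of_def right_of_def strict_at_def neq_iff)
  moreover have "left_of N Q u \<inter> right_of N Q u = {}"
    by (auto simp: left_of_def right_of_def)
  ultimately have "card (left_of N Q u) + card (right_of N Q u) = card ({..<N} - {u})"
    by (metis card_Un_disjoint finite_left_right)
  then show ?thesis using assms by (simp add: strict_at_def)
qed

lemma card_above_below:
  assumes "strict_at N Q u"
  shows "card (above_pairs N Q u) + card (below_pairs N Q u) = card (left_of N Q u) * card (right_of N Q u)"
proof -
  have "above_pairs N Q u \<union> below_pairs N Q u = left_of N Q u \<times> right_of N Q u"
    using assms by (auto simp: above_pairs_def below_pairs_def strict_at_def neq_iff)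
  moreover have "above_pairs N Q u \<inter> below_pairs N Q u = {}"
    by (auto simp: above_pairs_def below_pairs_def)
  moreover have "finite (above_pairs N Q u)" "finite (below_pairs N Q u)"
    by (rule finite_subset[of _ "left_of N Q u \<times> right_of N Q u"]; auto simp: above_pairs_def below_pairs_def)+
  ultimately show ?thesis by (metis card_Un_disjoint card_cartesian_product)
qed

section \<open>A parabolic cap lifted to a great height\<close>

lemma eventually_affine_pos:
  fixes A B :: real
  assumes "B > 0"
  shows "\<forall>\<^sub>F R in at_top. A + B * R > 0"
  using eventually_gt_at_top[of "- A / B"]
  by eventually_elim (use assms in \<open>simp add: field_simps\<close>)

text \<open>The abscissas of the cap vertices stay fixed as \<open>R\<close> grows, so from each
  point of \<open>Q\<close> they are seen almost vertically and in the order of their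
  indices.\<close>

definition tower :: "nat \<Rightarrow> (nat \<Rightarrow> real ^ 2) \<Rightarrow> real \<Rightarrow> nat \<Rightarrow> real ^ 2" where
  "tower N Q R i = (if i < N then Q i else vector [real (i - N), R - (real (i - N))\<^sup>2])"

text \<open>Both orientations are affine in \<open>R\<close>, with leading coefficients
  \<open>Q a $ 1 - Q b $ 1\<close> and \<open>j - i\<close>.\<close>

lemma eventually_tower:
  "\<forall>\<^sub>F R in at_top. \<forall>t\<in>{..<N} \<times> {..<N} \<times> {..<M} \<times> {..<M}. case t of (a, b, i, j) \<Rightarrow>
     (Q a $ 1 < Q b $ 1 \<longrightarrow> orient (Q a) (tower N Q R (N + j)) (Q b) < 0) \<and>
     (i < j \<longrightarrow> orient (Q a) (tower N Q R (N + j)) (tower N Q R (N + i)) > 0)"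
proof (intro eventually_ball_finite ballI)
  fix t assume "t \<in> {..<N} \<times> {..<N} \<times> {..<M} \<times> {..<M}"
  obtain a b i j where t: "t = (a, b, i, j)" by (cases t)
  have "\<forall>\<^sub>F R in at_top. Q a $ 1 < Q b $ 1 \<longrightarrow> orient (Q a) (tower N Q R (N + j)) (Q b) < 0"
  proof (cases "Q a $ 1 < Q b $ 1")
    case True
    define A where "A = - ((j - Q a $ 1) * (Q b $ 2 - Q a $ 2) + ((real j)\<^sup>2 + Q a $ 2) * (Q b $ 1 - Q a $ 1))"
    have "orient (Q a) (tower N Q R (N + j)) (Q b) = - (A + (Q b $ 1 - Q a $ 1) * R)" for R
      by (simp add: orient_def tower_def A_def algebra_simps)
    moreover have "\<forall>\<^sub>F R in at_top. A + (Q b $ 1 - Q a $ 1) * R > 0"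
      using True by (intro eventually_affine_pos) simp
    ultimately show ?thesis by (auto elim: eventually_mono)
  qed simp
  moreover have "\<forall>\<^sub>F R in at_top. i < j \<longrightarrow> orient (Q a) (tower N Q R (N + j)) (tower N Q R (N + i)) > 0"
  proof (cases "i < j")
    case True
    define A where "A = ((real j)\<^sup>2 + Q a $ 2) * (i - Q a $ 1) - (j - Q a $ 1) * ((real i)\<^sup>2 + Q a $ 2)"
    have "orient (Q a) (tower N Q R (N + j)) (tower N Q R (N + i)) = A + (real j - real i) * R" for R
      by (simp add: orient_def tower_def A_def algebra_simps)
    moreover have "\<forall>\<^sub>F R in at_top. A + (real j - real i) * R > 0"
      using True by (intro eventually_affine_pos) simp
    ultimately show ?thesis by simp
  qed simp
  ultimately show "\<forall>\<^sub>F R in at_top. case t of (a, b, i, j) \<Rightarrow>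
     (Q a $ 1 < Q b $ 1 \<longrightarrow> orient (Q a) (tower N Q R (N + j)) (Q b) < 0) \<and>
     (i < j \<longrightarrow> orient (Q a) (tower N Q R (N + j)) (tower N Q R (N + i)) > 0)"
    unfolding t prod.case by (rule eventually_conj)
qed simp

text \<open>The edges from \<open>Q\<close> to the far-away cap \<open>v\<^sub>0, \<dots>, v\<^sub>M\<^sub>-\<^sub>1\<close> are nearly vertical, so that a pair of
  vertices on different sides of such an edge \<open>uv\<^sub>j\<close> fails to cross it only if both of its vertices are
  in \<open>Q\<close> and the segment passes below \<open>u\<close>.\<close>
lemma tower_crossings:
  obtains R where "\<And>u j. strict_at N Q u \<Longrightarrow> j < M \<Longrightarrow> strict_edge {..<N + M} (tower N Q R) u (N + j) \<and>
     card (crossing_pairs {..<N + M} (tower N Q R) u (N + j)) + card (below_pairs N Q u) =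
     (card (left_of N Q u) + j) * (card (right_of N Q u) + (M - 1 - j))"
proof -
  obtain R where R: "\<forall>t\<in>{..<N} \<times> {..<N} \<times> {..<M} \<times> {..<M}. case t of (a, b, i, j) \<Rightarrow>
     (Q a $ 1 < Q b $ 1 \<longrightarrow> orient (Q a) (tower N Q R (N + j)) (Q b) < 0) \<and>
     (i < j \<longrightarrow> orient (Q a) (tower N Q R (N + j)) (tower N Q R (N + i)) > 0)"
    using eventually_happens[OF eventually_tower[of N M Q]] by auto
  let ?T = "tower N Q R"
  define v where "v j = ?T (N + j)" for j
  have T: "?T a = Q a" if "a < N" for a using that by (simp add: tower_def)
  have h1: "orient (Q a) (v j) (Q b) < 0" if "a < N" "b < N" "j < M" "Q a $ 1 < Q b $ 1" for a b j
    using R[rule_format, of "(a, b, j, j)"] that by (simp add: v_def)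
  have h1': "orient (Q a) (Q b) (v j) > 0" if "a < N" "b < N" "j < M" "Q a $ 1 < Q b $ 1" for a b j
    using h1[OF that] orient_swap[of "Q a" "Q b" "v j"] orient_rotate[of "Q b" "Q a" "v j"]
      orient_rotate[of "Q a" "v j" "Q b"] by linarith
  have h2: "orient (Q a) (v j) (v i) > 0" if "a < N" "j < M" "i < j" for a i j
    using R[rule_format, of "(a, a, i, j)"] that by (simp add: v_def)
  have h2': "orient (v i) (v j) (Q a) < 0" if "a < N" "j < M" "i < j" for a i j
    using h2[OF that] orient_swap[of "v i" "v j" "Q a"] orient_rotate[of "v j" "v i" "Q a"] by linarith
  have h3: "orient (v i) (v l) (v j) > 0" if "i < j" "j < l" for i j l
  proof -
    have "orient (v i) (v l) (v j) = (real l - real i) * (real j - real i) * (real l - real j)"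
      by (simp add: v_def tower_def orient_def power2_eq_square algebra_simps)
    then show ?thesis using that by simp
  qed
  show ?thesis
  proof (rule that)
    fix u j assume u: "strict_at N Q u" and j: "j < M"
    have uN: "u < N" using u by (simp add: strict_at_def)
    \<comment> \<open>The two sides of the edge from \<open>u\<close> to \<open>v j\<close>: earlier
      cap vertices are on its left, later ones on its right.\<close>
    let ?L = "left_of N Q u \<union> (+) N ` {..<j}" and ?R = "right_of N Q u \<union> (+) N ` {j<..<M}"
    have L: "orient (?T u) (?T (N + j)) (?T y) > 0" if "y \<in> ?L" for y
      using that
    proof
      assume "y \<in> left_of N Q u"
      then have y: "y < N" "Q y $ 1 < Q u $ 1" by (auto simp: left_of_def)
      show ?thesis using h1'[OF y(1) uN j y(2)] T[OF uN] T[OF y(1)] orient_rotate[of "Q u" "v j" "Q y"]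
        by (simp add: v_def)
    next
      assume "y \<in> (+) N ` {..<j}"
      then show ?thesis using h2[OF uN j] T[OF uN] by (auto simp: v_def)
    qed
    have R: "orient (?T u) (?T (N + j)) (?T y) < 0" if "y \<in> ?R" for y
      using that
    proof
      assume "y \<in> right_of N Q u"
      then have y: "y < N" "Q u $ 1 < Q y $ 1" by (auto simp: right_of_def)
      show ?thesis using h1[OF uN y(1) j y(2)] T[OF uN] T[OF y(1)] by (simp add: v_def)
    next
      assume "y \<in> (+) N ` {j<..<M}"
      then obtain i where i: "y = N + i" "j < i" "i < M" by auto
      then show ?thesis using h2'[OF uN i(3,2)] T[OF uN] orient_rotate[of "v j" "v i" "Q u"]
        by (simp add: v_def)
    qed
    have cover: "y \<in> ?L \<or> y \<in> ?R" if "y < N + M" "y \<noteq> u" "y \<noteq> N + j" for y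
    proof (cases "y < N")
      case True
      then show ?thesis using u that by (auto simp: left_of_def right_of_def strict_at_def neq_iff)
    next
      case False
      then obtain i where "y = N + i" using le_iff_add[of N y] by auto
      then show ?thesis using that by (auto simp: neq_iff)
    qed
    have LV: "?L \<union> ?R \<subseteq> {..<N + M}" using j by (auto simp: left_of_def right_of_def)
    \<comment> \<open>Every segment directed from the left side to the right side has
      \<open>v j\<close> on its left.\<close>
    have yzv: "orient (?T y) (?T z) (?T (N + j)) > 0" if "y \<in> ?L" "z \<in> ?R" for y z
      using that
    proof (elim UnE)
      assume "y \<in> left_of N Q u" "z \<in> right_of N Q u"
      then show ?thesis using h1'[of y z j] j T by (auto simp: left_of_def right_of_def v_def)
    next
      assume y: "y \<in> left_of N Q u" and z: "z \<in> (+) N ` {j<..<M}"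
      then obtain i where "z = N + i" "j < i" "i < M" by auto
      then show ?thesis using y h2[of y i j] T by (auto simp: left_of_def v_def)
    next
      assume y: "y \<in> (+) N ` {..<j}" and z: "z \<in> right_of N Q u"
      then obtain i where "y = N + i" "i < j" by auto
      then show ?thesis using z h2[of z j i] j T orient_rotate[of "v i" "Q z" "v j"] orient_rotate[of "Q z" "v j" "v i"]
        by (auto simp: right_of_def v_def)
    next
      assume "y \<in> (+) N ` {..<j}" "z \<in> (+) N ` {j<..<M}"
      then show ?thesis using h3 by (auto simp: v_def)
    qed
    \<comment> \<open>It also has \<open>u\<close> on its right, and so crosses the edge, unless it
      is a segment of \<open>Q\<close> below \<open>u\<close>.\<close>
    have yzu: "(y, z) \<notin> below_pairs N Q u \<longrightarrow> orient (?T y) (?T z) (?T u) < 0" if "y \<in> ?L" "z \<in> ?R" for y z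
      using that
    proof (elim UnE)
      assume yz: "y \<in> left_of N Q u" "z \<in> right_of N Q u"
      then have "orient (Q y) (Q z) (Q u) \<noteq> 0" using u by (auto simp: strict_at_def)
      then show ?thesis using yz T uN by (auto simp: below_pairs_def left_of_def right_of_def)
    next
      assume y: "y \<in> left_of N Q u" and z: "z \<in> (+) N ` {j<..<M}"
      then obtain i where "z = N + i" "j < i" "i < M" by auto
      then show ?thesis using y h1[of y u i] T uN by (auto simp: left_of_def v_def)
    next
      assume y: "y \<in> (+) N ` {..<j}" and z: "z \<in> right_of N Q u"
      then obtain i where "y = N + i" "i < j" by auto
      then show ?thesis using z h1[of u z i] j T uN orient_rotate[of "v i" "Q z" "Q u"]
        by (auto simp: right_of_def v_def)
    next
      assume "y \<in> (+) N ` {..<j}" "z \<in> (+) N ` {j<..<M}"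
      then show ?thesis using h2' uN T by (auto simp: v_def)
    qed
    have B: "below_pairs N Q u \<subseteq> ?L \<times> ?R" by (auto simp: below_pairs_def)
    have yzu': "orient (?T y) (?T z) (?T u) > 0" if "(y, z) \<in> below_pairs N Q u" for y z
      using that T uN by (auto simp: below_pairs_def left_of_def right_of_def)
    have sides: "(y \<in> ?L \<longleftrightarrow> orient (?T u) (?T (N + j)) (?T y) > 0) \<and> (y \<in> ?R \<longleftrightarrow> orient (?T u) (?T (N + j)) (?T y) < 0)"
      if "y < N + M" for y
    proof (cases "y = u \<or> y = N + j")
      case True
      then have "orient (?T u) (?T (N + j)) (?T y) = 0" by auto
      then show ?thesis using L[of y] R[of y] by auto
    next
      case False
      then show ?thesis using cover[OF that] L[of y] R[of y] by fastforce
    qed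
    have "strict_edge {..<N + M} ?T u (N + j)"
      unfolding strict_edge_def
    proof (intro conjI ballI impI)
      fix y assume "y \<in> {..<N + M} - {u, N + j}"
      then show "orient (?T u) (?T (N + j)) (?T y) \<noteq> 0" using cover[of y] L[of y] R[of y] by fastforce
    next
      fix y z assume yz: "y \<in> {..<N + M}" "z \<in> {..<N + M}"
        "orient (?T u) (?T (N + j)) (?T y) > 0 \<and> orient (?T u) (?T (N + j)) (?T z) < 0"
      then have yz: "y \<in> ?L" "z \<in> ?R" using sides by auto
      show "orient (?T y) (?T z) (?T u) \<noteq> 0" using yzu[OF yz] yzu'[of y z] by fastforce
      show "orient (?T y) (?T z) (?T (N + j)) \<noteq> 0" using yzv[OF yz] by simp
    qed
    moreover have "crossing_pairs {..<N + M} ?T u (N + j) = ?L \<times> ?R - below_pairs N Q u"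
    proof (rule set_eqI)
      fix s :: "nat \<times> nat"
      obtain y z where s: "s = (y, z)" by (cases s)
      show "s \<in> crossing_pairs {..<N + M} ?T u (N + j) \<longleftrightarrow> s \<in> ?L \<times> ?R - below_pairs N Q u"
      proof
        assume "s \<in> crossing_pairs {..<N + M} ?T u (N + j)"
        then have "y < N + M" "z < N + M" "orient (?T u) (?T (N + j)) (?T y) > 0" "orient (?T u) (?T (N + j)) (?T z) < 0"
          "orient (?T y) (?T z) (?T u) < 0" unfolding s crossing_pairs_def by auto
        then show "s \<in> ?L \<times> ?R - below_pairs N Q u" unfolding s using sides[of y] sides[of z] yzu'[of y z] by auto
      next
        assume "s \<in> ?L \<times> ?R - below_pairs N Q u"
        then have *: "y \<in> ?L" "z \<in> ?R" "(y, z) \<notin> below_pairs N Q u" unfolding s by auto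
        have "y \<in> {..<N + M}" "z \<in> {..<N + M}" using * LV by blast+
        then show "s \<in> crossing_pairs {..<N + M} ?T u (N + j)"
          unfolding s crossing_pairs_def using L[OF *(1)] R[OF *(2)] yzv[OF *(1,2)] yzu[OF *(1,2)] *(3) by simp
      qed
    qed
    moreover have "card (?L \<times> ?R - below_pairs N Q u) + card (below_pairs N Q u) = card ?L * card ?R"
    proof -
      have fin: "finite (?L \<times> ?R)" by simp
      show ?thesis
        using card_Diff_subset[OF finite_subset[OF B fin] B] card_mono[OF fin B]
        unfolding card_cartesian_product by linarith
    qed
    moreover have "card ?L = card (left_of N Q u) + j"
      by (subst card_Un_disjoint) (auto simp: left_of_def card_image)
    moreover have "card ?R = card (right_of N Q u) + (M - 1 - j)"
      by (subst card_Un_disjoint) (auto simp: right_of_def card_image)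
    ultimately show "strict_edge {..<N + M} ?T u (N + j) \<and>
      card (crossing_pairs {..<N + M} ?T u (N + j)) + card (below_pairs N Q u) =
      (card (left_of N Q u) + j) * (card (right_of N Q u) + (M - 1 - j))" by simp
  qed
qed

section \<open>Points with a prescribed number of segments above them\<close>

definition roof_config :: "nat \<Rightarrow> (nat \<Rightarrow> real ^ 2) \<Rightarrow> nat set \<Rightarrow> nat \<Rightarrow> bool" where
  "roof_config N Q D r \<longleftrightarrow> (\<forall>u\<in>D. strict_at N Q u \<and> card (above_pairs N Q u) = r)"

text \<open>The piecewise linear interpolation of \<open>i\<^sup>2 / w\<close> at the multiples of
  \<open>w\<close>; it is convex with slope \<open>2 * q + 1\<close> on block \<open>q\<close>, so
  its negative is a cap.\<close>

definition chain_slope :: "nat \<Rightarrow> nat \<Rightarrow> real" where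
  "chain_slope w i = (real (i div w))\<^sup>2 * w + (2 * real (i div w) + 1) * real (i mod w)"

text \<open>The square of \<open>i mod w\<close> bends the inner points of a block into a cap; the
  offset \<open>w\<^sup>2\<close> lowers them enough that a segment from a block end passes above
  all inner points it spans.\<close>

definition chain_dip :: "nat \<Rightarrow> nat \<Rightarrow> real" where
  "chain_dip w i = (if i mod w = 0 then 0 else (real w)\<^sup>2 + (real (i mod w))\<^sup>2)"

text \<open>A piecewise linear cap with vertices at the multiples of \<open>w\<close>; the other points are pushed
  slightly below their chord, along a much flatter cap.\<close>
definition chain :: "nat \<Rightarrow> real \<Rightarrow> nat \<Rightarrow> real ^ 2" where
  "chain w K i = vector [real i, - K * chain_slope w i - chain_dip w i]"

text \<open>\<open>\<Delta>\<close> is the height of the convex interpolation over the line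
  extending its block \<open>g\<close>. It is an integer computed from the number \<open>e\<close>
  of blocks between, and vanishes only on the closed block.\<close>

lemma chain_slope_gap:
  assumes w: "w > 0"
  obtains \<Delta> :: real where "\<Delta> = 0 \<or> \<Delta> \<ge> 2" "\<Delta> = 0 \<longleftrightarrow> g * w \<le> i \<and> i \<le> (g + 1) * w"
    "chain_slope w i = (real g)\<^sup>2 * w + (2 * real g + 1) * (real i - real g * w) + \<Delta>"
proof -
  define q s where "q = i div w" and "s = i mod w"
  have i: "i = q * w + s" and s: "s < w" using w by (simp_all add: q_def s_def)
  define e where "e = int q - int g"
  define d where "d = int w * (e\<^sup>2 - e) + 2 * e * int s"
  have re: "real q = real g + of_int e" by (simp add: e_def)
  have eq: "chain_slope w i = (real g)\<^sup>2 * w + (2 * real g + 1) * (real i - real g * w) + real_of_int d"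
    unfolding chain_slope_def q_def[symmetric] s_def[symmetric] unfolding i d_def
    by (simp add: re power2_eq_square algebra_simps)
  have "(d = 0 \<or> d \<ge> 2) \<and> (d = 0 \<longleftrightarrow> g * w \<le> i \<and> i \<le> (g + 1) * w)"
  proof -
    consider "e = 0" | "e = 1" | "e \<ge> 2" | "e \<le> -1" by linarith
    then show ?thesis
    proof cases
      case 1
      then have "q = g" by (simp add: e_def)
      then show ?thesis using 1 i s by (simp add: d_def)
    next
      case 2
      \<comment> \<open>Here \<open>d = 2 * s\<close>, which is zero only at \<open>s = 0\<close>,
        the right end of block \<open>g\<close>.\<close>
      then have "q = g + 1" by (simp add: e_def)
      then show ?thesis using 2 i s by (auto simp: d_def)
    next
      case 3
      have "2 * 1 \<le> e * (e - 1)" using 3 by (intro mult_mono) auto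
      then have "1 * 2 \<le> int w * (e\<^sup>2 - e)" using w
        by (intro mult_mono) (auto simp: power2_eq_square algebra_simps)
      moreover have "0 \<le> 2 * e * int s" using 3 by simp
      ultimately have d: "d \<ge> 2" unfolding d_def by linarith
      have "q \<ge> g + 2" using 3 by (simp add: e_def)
      then have "(g + 2) * w \<le> q * w" by (rule mult_le_mono1)
      then have "\<not> i \<le> (g + 1) * w" using i w by (simp add: algebra_simps)
      then show ?thesis using d by auto
    next
      case 4
      \<comment> \<open>\<open>d\<close> is smallest at \<open>s = w - 1\<close>, where it equals
        \<open>w * (e\<^sup>2 + e) - 2 * e\<close>.\<close>
      have "0 \<le> (- e - 1) * (- e)" using 4 by (intro mult_nonneg_nonneg) auto
      then have "0 \<le> int w * (e\<^sup>2 + e)" by (intro mult_nonneg_nonneg) (auto simp: power2_eq_square algebra_simps)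
      moreover have "(- e) * int s \<le> (- e) * (int w - 1)" using 4 s by (intro mult_left_mono) auto
      ultimately have d: "d \<ge> 2" using 4 unfolding d_def by (simp add: algebra_simps)
      have "q + 1 \<le> g" using 4 by (simp add: e_def)
      then have "(q + 1) * w \<le> g * w" by (rule mult_le_mono1)
      then have "\<not> g * w \<le> i" using i s by (simp add: algebra_simps)
      then show ?thesis using d by auto
    qed
  qed
  then show ?thesis using that[of "real_of_int d"] eq by auto
qed

lemma chain_dip_bounds: "w > 0 \<Longrightarrow> 0 \<le> chain_dip w i" "w > 0 \<Longrightarrow> chain_dip w i < 2 * (real w)\<^sup>2"
proof -
  assume "w > 0"
  then have "(real (i mod w))\<^sup>2 < (real w)\<^sup>2" by (intro power_strict_mono) auto
  then show "chain_dip w i < 2 * (real w)\<^sup>2" using \<open>w > 0\<close> by (auto simp: chain_dip_def)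
qed (simp add: chain_dip_def)

lemma chain_dip_shift: "\<alpha> < w \<Longrightarrow> chain_dip w (g * w + \<alpha>) = (if \<alpha> = 0 then 0 else (real w)\<^sup>2 + (real \<alpha>)\<^sup>2)"
  by (simp add: chain_dip_def)

text \<open>\<open>val\<close> is the orientation of three points of one block, the linear part
  having cancelled. For inner ends it is the product of the three gaps; a block end has dip zero,
  and the offset then makes \<open>val\<close> negative.\<close>

lemma chain_dip_orient:
  fixes \<alpha> \<beta> s w g :: nat
  assumes "\<alpha> < s" "s < \<beta>" "\<beta> \<le> w"
  defines "val \<equiv> (\<beta> - real s) * chain_dip w (g * w + \<alpha>) + (s - real \<alpha>) * chain_dip w (g * w + \<beta>)
     - (\<beta> - real \<alpha>) * chain_dip w (g * w + s)"
  shows "val \<noteq> 0" "val < 0 \<longleftrightarrow> \<alpha> = 0 \<or> \<beta> = w"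
proof -
  have s: "0 < s" "s < w" using assms by auto
  have ds: "chain_dip w (g * w + s) = (real w)\<^sup>2 + (real s)\<^sup>2" using s by (simp add: chain_dip_shift)
  have dw: "chain_dip w (g * w + w) = 0" using s by (simp add: chain_dip_def)
  have neg: "val < 0" if "\<alpha> = 0 \<or> \<beta> = w"
  proof (cases "\<beta> = w")
    case True
    have "(w - real s) * chain_dip w (g * w + \<alpha>) < (w - real \<alpha>) * chain_dip w (g * w + s)"
    proof (cases "\<alpha> = 0")
      case True
      then show ?thesis using s ds by (auto simp: chain_dip_def[of w "g * w"] intro!: mult_pos_pos add_pos_pos)
    next
      case False
      have "(real \<alpha>)\<^sup>2 < (real s)\<^sup>2" using assms by (intro power_strict_mono) auto
      then have "(w - real s) * ((real w)\<^sup>2 + (real \<alpha>)\<^sup>2) < (w - real \<alpha>) * ((real w)\<^sup>2 + (real s)\<^sup>2)"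
        using assms s by (intro mult_strict_mono) (auto intro!: add_nonneg_pos)
      then show ?thesis using assms s ds False by (simp add: chain_dip_shift)
    qed
    then show ?thesis unfolding val_def True dw by simp
  next
    case False
    then have a: "\<alpha> = 0" "\<beta> < w" using that assms by auto
    \<comment> \<open>This is why the offset is as large as \<open>w\<^sup>2\<close>.\<close>
    have "s * real \<beta> < real w * real w"
      using assms s a by (intro mult_strict_mono) auto
    then have "(\<beta> - real s) * (s * real \<beta> - real w * real w) < 0"
      using assms by (intro mult_pos_neg) auto
    moreover have "val = (\<beta> - real s) * (s * real \<beta> - real w * real w)"
    proof -
      have d: "chain_dip w (g * w) = 0" "chain_dip w (g * w + \<beta>) = (real w)\<^sup>2 + (real \<beta>)\<^sup>2"
        using a s assms(1-3) by (simp_all add: chain_dip_shift chain_dip_def[of w "g * w"])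
      show ?thesis unfolding val_def ds d(2) unfolding a(1) add_0_right d(1)
        by (simp add: power2_eq_square algebra_simps)
    qed
    ultimately show ?thesis by simp
  qed
  have pos: "val > 0" if "\<not> (\<alpha> = 0 \<or> \<beta> = w)"
  proof -
    have d: "chain_dip w (g * w + \<alpha>) = (real w)\<^sup>2 + (real \<alpha>)\<^sup>2" "chain_dip w (g * w + \<beta>) = (real w)\<^sup>2 + (real \<beta>)\<^sup>2"
      using that s assms(1-3) by (simp_all add: chain_dip_shift)
    have "val = (\<beta> - real s) * (s - real \<alpha>) * (\<beta> - real \<alpha>)"
      unfolding val_def ds d by (simp add: power2_eq_square algebra_simps)
    then show ?thesis using assms by simp
  qed
  show "val \<noteq> 0" "val < 0 \<longleftrightarrow> \<alpha> = 0 \<or> \<beta> = w" using neg pos by (metis less_irrefl less_asym)+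
qed

lemma left_right_of_real:
  assumes "\<And>i. Q i $ 1 = real i" "u < N"
  shows "left_of N Q u = {..<u}" "right_of N Q u = {u<..<N}"
  using assms by (auto simp: left_of_def right_of_def)

text \<open>Segments leaving the block pass below \<open>g * w + s\<close>. Within it, those above
  join the left end to one of the \<open>w - s\<close> later points or one of the
  \<open>s - 1\<close> earlier inner points to the right end.\<close>

lemma chain_above_pairs:
  assumes w: "w \<ge> 2" and K: "K \<ge> real N * (real w)\<^sup>2" and s: "0 < s" "s < w" and N: "(g + 1) * w < N"
  shows "strict_at N (chain w K) (g * w + s) \<and> card (above_pairs N (chain w K) (g * w + s)) = w - 1"
proof -
  let ?u = "g * w + s" and ?Q = "chain w K"
  have uN: "?u < N" using N s by (simp add: algebra_simps)
  have x: "?Q i $ 1 = real i" for i by (simp add: chain_def)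
  have L: "left_of N ?Q ?u = {..<?u}" and R: "right_of N ?Q ?u = {?u<..<N}"
    using left_right_of_real[of ?Q, OF x uN] by auto
  have "\<forall>i. \<exists>d :: real. (d = 0 \<or> d \<ge> 2) \<and> (d = 0 \<longleftrightarrow> g * w \<le> i \<and> i \<le> (g + 1) * w) \<and>
    chain_slope w i = (real g)\<^sup>2 * w + (2 * real g + 1) * (real i - real g * w) + d"
  proof
    fix i
    have "w > 0" using w by simp
    then show "\<exists>d :: real. (d = 0 \<or> d \<ge> 2) \<and> (d = 0 \<longleftrightarrow> g * w \<le> i \<and> i \<le> (g + 1) * w) \<and>
      chain_slope w i = (real g)\<^sup>2 * w + (2 * real g + 1) * (real i - real g * w) + d"
      by (rule chain_slope_gap[of w g i]) blast
  qed
  from choice[OF this] obtain \<Delta> where D: "\<And>i. \<Delta> i = 0 \<or> \<Delta> i \<ge> (2 :: real)"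
    "\<And>i. \<Delta> i = 0 \<longleftrightarrow> g * w \<le> i \<and> i \<le> (g + 1) * w"
    "\<And>i. chain_slope w i = (real g)\<^sup>2 * w + (2 * real g + 1) * (real i - real g * w) + \<Delta> i"
    by blast
  have Du: "\<Delta> ?u = 0" using D(2)[of ?u] s by simp
  \<comment> \<open>The line through block \<open>g\<close> drops out, leaving only the dips and the
    gaps.\<close>
  have orient: "orient (?Q a) (?Q b) (?Q ?u) =
      (b - real ?u) * chain_dip w a + (?u - real a) * chain_dip w b - (b - real a) * chain_dip w ?u
      + K * ((b - real ?u) * \<Delta> a + (?u - real a) * \<Delta> b)" for a b
  proof -
    have y: "?Q i $ 2 = - K * ((real g)\<^sup>2 * w + (2 * real g + 1) * (real i - real g * w) + \<Delta> i) - chain_dip w i" for i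
      by (simp add: chain_def D(3)[of i])
    show ?thesis unfolding orient_def x y Du
      by (simp add: algebra_simps)
  qed
  let ?in = "\<lambda>i. g * w \<le> i \<and> i \<le> (g + 1) * w"
  let ?up = "\<lambda>a b. ?in a \<and> ?in b \<and> (a = g * w \<or> b = (g + 1) * w)"
  have sgn: "orient (?Q a) (?Q b) (?Q ?u) \<noteq> 0 \<and> (orient (?Q a) (?Q b) (?Q ?u) < 0 \<longleftrightarrow> ?up a b)"
    if ab: "a < ?u" "?u < b" "b < N" for a b
  proof (cases "?in a \<and> ?in b")
    case True
    define \<alpha> \<beta> where "\<alpha> = a - g * w" and "\<beta> = b - g * w"
    have a: "a = g * w + \<alpha>" and b: "b = g * w + \<beta>" using True by (simp_all add: \<alpha>_def \<beta>_def)
    have le: "\<alpha> < s" "s < \<beta>" "\<beta> \<le> w" using ab True unfolding a b by auto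
    have D0: "\<Delta> a = 0" "\<Delta> b = 0" using D(2)[of a] D(2)[of b] True by auto
    have "orient (?Q a) (?Q b) (?Q ?u) = (\<beta> - real s) * chain_dip w (g * w + \<alpha>) + (s - real \<alpha>) * chain_dip w (g * w + \<beta>)
     - (\<beta> - real \<alpha>) * chain_dip w (g * w + s)"
      unfolding orient D0 by (simp add: a b)
    then show ?thesis using chain_dip_orient[OF le, of g] True by (auto simp: a b)
  next
    case False
    have w0: "0 < w" using w by simp
    \<comment> \<open>The only negative term is less than \<open>N * 2 * w\<^sup>2\<close>, at most
      \<open>2 * K\<close>, while an end outside the block contributes at least
      \<open>2 * K\<close>.\<close>
    have "(b - real a) * chain_dip w ?u < (b - real a) * (2 * (real w)\<^sup>2)"
      using ab chain_dip_bounds(2)[OF w0, of ?u] by (intro mult_strict_left_mono) auto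
    also have "\<dots> \<le> real N * (2 * (real w)\<^sup>2)" using ab by (intro mult_right_mono) auto
    also have "\<dots> \<le> K * 2" using K by simp
    also have "\<dots> \<le> K * ((b - real ?u) * \<Delta> a + (?u - real a) * \<Delta> b)"
    proof (rule mult_left_mono)
      have "0 \<le> real N * (real w)\<^sup>2" by simp
      then show "0 \<le> K" using K by linarith
      have nn: "\<Delta> a \<ge> 0" "\<Delta> b \<ge> 0" using D(1)[of a] D(1)[of b] by auto
      have f: "1 \<le> b - real ?u" "1 \<le> ?u - real a" using ab by linarith+
      have p: "1 * \<Delta> a \<le> (b - real ?u) * \<Delta> a" "1 * \<Delta> b \<le> (?u - real a) * \<Delta> b"
        using f nn by (intro mult_right_mono; simp)+
      have "\<Delta> a \<ge> 2 \<or> \<Delta> b \<ge> 2" using False D(1,2)[of a] D(1,2)[of b] by blast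
      then show "2 \<le> (b - real ?u) * \<Delta> a + (?u - real a) * \<Delta> b" using p nn by linarith
    qed
    finally have "(b - real a) * chain_dip w ?u < K * ((b - real ?u) * \<Delta> a + (?u - real a) * \<Delta> b)" .
    moreover have "0 \<le> b - real ?u" "0 \<le> ?u - real a" using ab by linarith+
    then have "0 \<le> (b - real ?u) * chain_dip w a" "0 \<le> (?u - real a) * chain_dip w b"
      using chain_dip_bounds(1)[OF w0] mult_nonneg_nonneg by blast+
    ultimately have "orient (?Q a) (?Q b) (?Q ?u) > 0" unfolding orient by linarith
    then show ?thesis using False by auto
  qed
  have "strict_at N ?Q ?u"
    unfolding strict_at_def L R x of_nat_eq_iff using uN sgn by auto
  moreover have "above_pairs N ?Q ?u = {g * w} \<times> {?u<..(g + 1) * w} \<union> {g * w<..<?u} \<times> {(g + 1) * w}" (is "_ = ?A \<union> ?B")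
  proof (rule set_eqI)
    fix ab :: "nat \<times> nat"
    obtain a b where ab: "ab = (a, b)" by (cases ab)
    have "ab \<in> above_pairs N ?Q ?u \<longleftrightarrow> a < ?u \<and> ?u < b \<and> b < N \<and> ?up a b"
      using sgn[of a b] unfolding above_pairs_def L R ab by auto
    also have "\<dots> \<longleftrightarrow> ab \<in> ?A \<union> ?B" using N s unfolding ab by auto
    finally show "ab \<in> above_pairs N ?Q ?u \<longleftrightarrow> ab \<in> ?A \<union> ?B" .
  qed
  moreover have "card (?A \<union> ?B) = w - 1"
  proof -
    have "card (?A \<union> ?B) = card ?A + card ?B" by (rule card_Un_disjoint) auto
    then show ?thesis using s by (simp add: card_cartesian_product)
  qed
  ultimately show ?thesis by simp
qed

lemma roof_config_chain:
  assumes "t \<ge> 1"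
  obtains Q D where "roof_config N Q D t" "\<And>i. Q i $ 1 = real i" "t * ((N - 1) div (t + 1)) \<le> card D"
proof -
  define w where "w = t + 1"
  define f where "f = (\<lambda>(g, s). g * w + s)"
  \<comment> \<open>Only the inner points of complete blocks; dividing \<open>N - 1\<close> ensures
    that the right end of the last block is still one of the \<open>N\<close> points.\<close>
  define D where "D = f ` ({..<(N - 1) div w} \<times> {1..<w})"
  let ?Q = "chain w (real N * (real w)\<^sup>2)"
  have "roof_config N ?Q D t"
    unfolding roof_config_def
  proof
    fix u assume "u \<in> D"
    then obtain g s where u: "u = g * w + s" "g < (N - 1) div w" "1 \<le> s" "s < w" by (auto simp: D_def f_def)
    have "(g + 1) * w \<le> (N - 1) div w * w" using u(2) by (intro mult_le_mono1) simp
    also have "\<dots> \<le> N - 1" by simp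
    finally have le: "(g + 1) * w \<le> N - 1" .
    moreover have "0 < (g + 1) * w" by (simp add: w_def)
    ultimately have "(g + 1) * w < N" by linarith
    then show "strict_at N ?Q u \<and> card (above_pairs N ?Q u) = t"
      using chain_above_pairs[of w N "real N * (real w)\<^sup>2" s g] u assms by (simp add: w_def)
  qed
  moreover have "?Q i $ 1 = real i" for i by (simp add: chain_def)
  moreover have "t * ((N - 1) div (t + 1)) \<le> card D"
  proof -
    have "inj_on f ({..<(N - 1) div w} \<times> {1..<w})"
    proof (rule inj_onI, clarify)
      fix g s g' s' assume "f (g, s) = f (g', s')" "s \<in> {1..<w}" "s' \<in> {1..<w}"
      then have eq: "g * w + s = g' * w + s'" "s < w" "s' < w" by (auto simp: f_def)
      have "(g * w + s) div w = g" "(g' * w + s') div w = g'" using eq(2,3) by simp_all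
      then have "g = g'" using eq(1) by simp
      then show "g = g' \<and> s = s'" using eq(1) by simp
    qed
    then have "card D = (N - 1) div w * (w - 1)"
      unfolding D_def by (simp add: card_image card_cartesian_product)
    then show ?thesis by (simp add: w_def mult.commute)
  qed
  ultimately show ?thesis using that by blast
qed

text \<open>On a downward parabola every chord passes below the points between its ends.\<close>

lemma roof_config_zero:
  obtains Q where "roof_config N Q {..<N} 0" "\<And>i. Q i $ 1 = real i"
proof -
  define Q :: "nat \<Rightarrow> real ^ 2" where "Q i = vector [real i, - (real i)\<^sup>2]" for i
  have x: "Q i $ 1 = real i" for i by (simp add: Q_def)
  have pos: "orient (Q a) (Q b) (Q u) > 0" if "a < u" "u < b" for a b u
  proof -
    have "orient (Q a) (Q b) (Q u) = (b - real a) * (b - real u) * (u - real a)"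
      by (simp add: Q_def orient_def power2_eq_square algebra_simps)
    then show ?thesis using that by simp
  qed
  have "strict_at N Q u \<and> card (above_pairs N Q u) = 0" if "u < N" for u
  proof -
    have "orient (Q a) (Q b) (Q u) > 0" if "a \<in> left_of N Q u" "b \<in> right_of N Q u" for a b
      using that pos[of a u b] by (auto simp: left_of_def right_of_def x)
    then have "strict_at N Q u" "above_pairs N Q u = {}"
      using that by (fastforce simp: strict_at_def x above_pairs_def)+
    then show ?thesis by simp
  qed
  then show ?thesis using that[of Q] x by (auto simp: roof_config_def)
qed

section \<open>Adding outer points on both sides of a core\<close>

lemma eventually_affine_sgn:
  fixes A B :: real
  assumes "B \<noteq> 0"
  shows "\<forall>\<^sub>F H in at_top. A - B * H \<noteq> 0 \<and> (A - B * H < 0 \<longleftrightarrow> B > 0)"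
proof (cases "B > 0")
  case True
  have "\<forall>\<^sub>F H in at_top. - A + B * H > 0" by (rule eventually_affine_pos[OF True])
  then show ?thesis by eventually_elim (use True in auto)
next
  case False
  have "\<forall>\<^sub>F H in at_top. A + (- B) * H > 0" by (rule eventually_affine_pos) (use False assms in auto)
  then show ?thesis by eventually_elim (use False in auto)
qed

text \<open>The outer points stand on two vertical lines, at heights proportional to
  \<open>H\<close>; this degeneracy is allowed because strictness is claimed only at core
  points.\<close>

definition outskirts :: "nat \<Rightarrow> (nat \<Rightarrow> real ^ 2) \<Rightarrow> nat \<Rightarrow> (nat \<Rightarrow> real) \<Rightarrow> real \<Rightarrow> nat \<Rightarrow> real ^ 2" where
  "outskirts m Q l h H i = (if i < m then Q i else vector [if i < l then -1 else real m, h i * H])"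

text \<open>For large \<open>H\<close>, a segment from an outer point to a core point passes above
  the core points between exactly if its \<open>h\<close> is positive; over \<open>u\<close> there
  are \<open>m - 1 - u\<close> such ends for a left outer point and \<open>u\<close> for a right
  one. For two outer points a weighted mean of their \<open>h\<close> decides.\<close>

lemma outskirts_above_pairs:
  assumes x: "\<And>i. Q i $ 1 = real i" and l: "m \<le> l" "l \<le> N"
    and h: "\<And>i. m \<le> i \<Longrightarrow> i < N \<Longrightarrow> h i \<noteq> 0"
    and P: "\<And>i j u. m \<le> i \<Longrightarrow> i < l \<Longrightarrow> l \<le> j \<Longrightarrow> j < N \<Longrightarrow> u < m \<Longrightarrow>
      h i * (m - real u) + h j * (u + 1) \<noteq> 0 \<and> (h i * (m - real u) + h j * (u + 1) > 0 \<longleftrightarrow> P i j)"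
  obtains H where "\<And>u. strict_at m Q u \<Longrightarrow> strict_at N (outskirts m Q l h H) u \<and>
    card (above_pairs N (outskirts m Q l h H) u) = card (above_pairs m Q u)
      + card {i \<in> {m..<l}. h i > 0} * (m - 1 - u) + card {j \<in> {l..<N}. h j > 0} * u
      + card {(i, j) \<in> {m..<l} \<times> {l..<N}. P i j}"
proof -
  let ?E = "outskirts m Q l h"
  let ?base = "\<lambda>H (i, v, u). v \<noteq> u \<longrightarrow>
     (if i < l then u < v \<longrightarrow> orient (?E H i) (?E H v) (?E H u) \<noteq> 0 \<and> (orient (?E H i) (?E H v) (?E H u) < 0 \<longleftrightarrow> h i > 0)
      else v < u \<longrightarrow> orient (?E H v) (?E H i) (?E H u) \<noteq> 0 \<and> (orient (?E H v) (?E H i) (?E H u) < 0 \<longleftrightarrow> h i > 0))"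
  let ?outer = "\<lambda>H (i, j, u). orient (?E H i) (?E H j) (?E H u) \<noteq> 0 \<and> (orient (?E H i) (?E H j) (?E H u) < 0 \<longleftrightarrow> P i j)"
  have ev1: "\<forall>\<^sub>F H in at_top. \<forall>t\<in>{m..<N} \<times> {..<m} \<times> {..<m}. ?base H t"
  proof (intro eventually_ball_finite ballI)
    fix t assume "t \<in> {m..<N} \<times> {..<m} \<times> {..<m}"
    then obtain i v u where t: "t = (i, v, u)" "m \<le> i" "i < N" "v < m" "u < m" by auto
    consider "i < l" "u < v" | "\<not> i < l" "v < u" | "v = u \<or> (i < l \<and> v < u) \<or> (\<not> i < l \<and> u < v)" by linarith
    then show "\<forall>\<^sub>F H in at_top. ?base H t"
    proof cases
      case 1
      define A where "A = (v + 1) * Q u $ 2 - Q v $ 2 * (u + 1)"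
      have eq: "orient (?E H i) (?E H v) (?E H u) = A - (h i * (v - real u)) * H" for H
        using t 1 by (simp add: outskirts_def orient_def x A_def algebra_simps)
      have "h i * (v - real u) \<noteq> 0" "h i * (v - real u) > 0 \<longleftrightarrow> h i > 0"
        using h[of i] t 1 by (auto simp: zero_less_mult_iff)
      with eventually_affine_sgn[of "h i * (v - real u)" A]
      show ?thesis using t 1 by (simp add: eq)
    next
      case 2
      define A where "A = (m - real v) * (Q u $ 2 - Q v $ 2) + Q v $ 2 * (u - real v)"
      have eq: "orient (?E H v) (?E H i) (?E H u) = A - (h i * (u - real v)) * H" for H
        using t 2 by (simp add: outskirts_def orient_def x A_def algebra_simps)
      have "h i * (u - real v) \<noteq> 0" "h i * (u - real v) > 0 \<longleftrightarrow> h i > 0"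
        using h[of i] t 2 by (auto simp: zero_less_mult_iff)
      with eventually_affine_sgn[of "h i * (u - real v)" A]
      show ?thesis using t 2 by (simp add: eq)
    next
      case 3
      then show ?thesis using t by auto
    qed
  qed simp
  have ev2: "\<forall>\<^sub>F H in at_top. \<forall>t\<in>{m..<l} \<times> {l..<N} \<times> {..<m}. ?outer H t"
  proof (intro eventually_ball_finite ballI)
    fix t assume "t \<in> {m..<l} \<times> {l..<N} \<times> {..<m}"
    then obtain i j u where t: "t = (i, j, u)" "m \<le> i" "i < l" "l \<le> j" "j < N" "u < m" by auto
    \<comment> \<open>\<open>B * H / (m + 1)\<close> is the height of the segment at the abscissa of
      \<open>u\<close>.\<close>
    define B where "B = h i * (m - real u) + h j * (real u + 1)"
    have eq: "orient (?E H i) (?E H j) (?E H u) = (m + 1) * Q u $ 2 - B * H" for H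
      using t by (simp add: outskirts_def orient_def x B_def algebra_simps)
    have B: "B \<noteq> 0" "B > 0 \<longleftrightarrow> P i j" using P[OF t(2-)] by (simp_all add: B_def)
    show "\<forall>\<^sub>F H in at_top. ?outer H t"
      using eventually_affine_sgn[OF B(1), of "(m + 1) * Q u $ 2"] unfolding t(1) prod.case eq B(2) .
  qed simp
  obtain H where H: "(\<forall>t\<in>{m..<N} \<times> {..<m} \<times> {..<m}. ?base H t) \<and> (\<forall>t\<in>{m..<l} \<times> {l..<N} \<times> {..<m}. ?outer H t)"
    using eventually_happens'[OF trivial_limit_at_top_linorder eventually_conj[OF ev1 ev2]] by blast
  note H1 = bspec[OF conjunct1[OF H]] and H2 = bspec[OF conjunct2[OF H]]
  show ?thesis
  proof (rule that[of H])
    fix u assume u: "strict_at m Q u"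
    then have um: "u < m" by (simp add: strict_at_def)
    let ?F = "?E H"
    have LR: "left_of m Q u = {..<u}" "right_of m Q u = {u<..<m}" using left_right_of_real[of Q, OF x um] by auto
    have L: "left_of N ?F u = {..<u} \<union> {m..<l}" and R: "right_of N ?F u = {u<..<m} \<union> {l..<N}"
      using um l by (auto simp: left_of_def right_of_def outskirts_def x split: if_splits)
    have Fm: "?F i = Q i" if "i < m" for i using that by (simp add: outskirts_def)
    have s1: "orient (?F a) (?F b) (?F u) \<noteq> 0" if "a < u" "u < b" "b < m" for a b
      using u that um unfolding strict_at_def LR by (simp add: Fm)
    have s2: "orient (?F i) (?F b) (?F u) \<noteq> 0 \<and> (orient (?F i) (?F b) (?F u) < 0 \<longleftrightarrow> h i > 0)"
      if "m \<le> i" "i < l" "u < b" "b < m" for i b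
      using H1[of "(i, b, u)"] that um l by simp
    have s3: "orient (?F a) (?F j) (?F u) \<noteq> 0 \<and> (orient (?F a) (?F j) (?F u) < 0 \<longleftrightarrow> h j > 0)"
      if "l \<le> j" "j < N" "a < u" for a j
      using H1[of "(j, a, u)"] that um l by simp
    have s4: "orient (?F i) (?F j) (?F u) \<noteq> 0 \<and> (orient (?F i) (?F j) (?F u) < 0 \<longleftrightarrow> P i j)"
      if "m \<le> i" "i < l" "l \<le> j" "j < N" for i j
      using H2[of "(i, j, u)"] that um by simp
    have "strict_at N ?F u"
      unfolding strict_at_def L R
    proof (intro conjI ballI allI impI)
      show "u < N" using um l by simp
      show "?F i $ 1 \<noteq> ?F u $ 1" if "i < N" "i \<noteq> u" for i
        using that um by (auto simp: outskirts_def x)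
      show "orient (?F a) (?F b) (?F u) \<noteq> 0" if "a \<in> {..<u} \<union> {m..<l}" "b \<in> {u<..<m} \<union> {l..<N}" for a b
        using that s1[of a b] s2[of a b] s3[of b a] s4[of a b] by auto
    qed
    moreover have "card (above_pairs N ?F u) = card (above_pairs m Q u)
      + card {i \<in> {m..<l}. h i > 0} * (m - 1 - u) + card {j \<in> {l..<N}. h j > 0} * u
      + card {(i, j) \<in> {m..<l} \<times> {l..<N}. P i j}"
    proof -
      let ?A = "above_pairs m Q u" and ?B = "{i \<in> {m..<l}. h i > 0} \<times> {u<..<m}"
      let ?C = "{..<u} \<times> {j \<in> {l..<N}. h j > 0}" and ?D = "{(i, j) \<in> {m..<l} \<times> {l..<N}. P i j}"
      have "above_pairs N ?F u = ?A \<union> ?B \<union> ?C \<union> ?D"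
      proof (rule set_eqI)
        fix ab :: "nat \<times> nat"
        obtain a b where ab: "ab = (a, b)" by (cases ab)
        have A: "(a, b) \<in> ?A \<longleftrightarrow> a < u \<and> u < b \<and> b < m \<and> orient (?F a) (?F b) (?F u) < 0"
          using um by (auto simp: above_pairs_def LR Fm)
        have "(a, b) \<in> above_pairs N ?F u \<longleftrightarrow> (a < u \<or> m \<le> a \<and> a < l) \<and> (u < b \<and> b < m \<or> l \<le> b \<and> b < N) \<and> orient (?F a) (?F b) (?F u) < 0"
          by (auto simp: above_pairs_def L R)
        also have "\<dots> \<longleftrightarrow> (a, b) \<in> ?A \<union> ?B \<union> ?C \<union> ?D"
          unfolding Un_iff A using s2[of a b] s3[of b a] s4[of a b] by auto
        finally show "ab \<in> above_pairs N ?F u \<longleftrightarrow> ab \<in> ?A \<union> ?B \<union> ?C \<union> ?D" unfolding ab .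
      qed
      moreover have fin: "finite ?A" "finite ?B" "finite ?C" "finite ?D"
        by (rule finite_subset[of _ "{..<u} \<times> {u<..<m}"], auto simp: above_pairs_def LR)
           (rule finite_subset[of _ "{m..<l} \<times> {l..<N}"], auto)
      moreover have "card (?A \<union> ?B \<union> ?C \<union> ?D) = card ?A + card ?B + card ?C + card ?D"
      proof -
        have "?A \<inter> ?B = {}" "(?A \<union> ?B) \<inter> ?C = {}" "(?A \<union> ?B \<union> ?C) \<inter> ?D = {}"
          using um l by (auto simp: above_pairs_def LR)
        then show ?thesis using fin by (simp add: card_Un_disjoint)
      qed
      ultimately show ?thesis by (simp add: card_cartesian_product algebra_simps)
    qed
    ultimately show "strict_at N ?F u \<and> card (above_pairs N ?F u) = card (above_pairs m Q u)
      + card {i \<in> {m..<l}. h i > 0} * (m - 1 - u) + card {j \<in> {l..<N}. h j > 0} * u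
      + card {(i, j) \<in> {m..<l} \<times> {l..<N}. P i j}" by simp
  qed
qed

text \<open>The \<open>a\<close> highest outer points on the left lie above all others, the next \<open>c\<close> are joined above
  the core with the \<open>b\<close> high outer points on the right only, and the remaining \<open>z\<close> lie so low that
  they are not joined above the core with any point.\<close>
lemma roof_config_extend:
  assumes Q: "roof_config m Q D r" "\<And>i. Q i $ 1 = real i"
    and s: "\<And>u. u \<in> D \<Longrightarrow> a * (m - 1 - u) + b * u = s"
  obtains Q' where "roof_config (m + a + c + z + b + d) Q' D (r + s + a * (b + d) + c * b)"
proof -
  define l where "l = m + a + c + z"
  define N where "N = l + b + d"
  \<comment> \<open>\<open>C\<close> is the sum of the weights \<open>m - u\<close> and
    \<open>u + 1\<close>, both at least \<open>1\<close>. Hence \<open>C\<close> outweighs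
    \<open>-1\<close>, and \<open>- C\<^sup>2\<close> outweighs \<open>C\<close>, at every core
    point.\<close>
  define C where "C = real m + 1"
  define h where "h i = (if i < m + a then C else if i < m + a + c then -1 else if i < l then - C\<^sup>2
     else if i < l + b then C else -1)" for i
  define P where "P i j \<longleftrightarrow> i < m + a \<or> i < m + a + c \<and> j < l + b" for i j
  have C: "C \<ge> 1" by (simp add: C_def)
  have hP: "h i * (m - real u) + h j * (u + 1) \<noteq> 0 \<and> (h i * (m - real u) + h j * (u + 1) > 0 \<longleftrightarrow> P i j)"
    if ij: "m \<le> i" "i < l" "l \<le> j" "j < N" "u < m" for i j u
  proof -
    define x y where "x = real m - u" and "y = real u + 1"
    have xy: "x \<ge> 1" "y \<ge> 1" "C = x + y" using ij by (auto simp: x_def y_def C_def)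
    have xyp: "0 < x * x" "0 < x * y" "0 < y * y" using xy by auto
    have le: "x \<le> x * y" "y \<le> x * y" "x * y \<le> x * (x * y)" "y * y \<le> x * (y * y)" "0 \<le> x * (x * x)"
      using xy mult_left_mono[of 1 y x] mult_right_mono[of 1 x y] mult_right_mono[of 1 x "x * y"]
        mult_right_mono[of 1 x "y * y"] by simp_all
    have "h i * x + h j * y \<noteq> 0 \<and> (h i * x + h j * y > 0 \<longleftrightarrow> P i j)"
    proof -
      consider "i < m + a" "j < l + b" | "i < m + a" "\<not> j < l + b"
        | "\<not> i < m + a" "i < m + a + c" "j < l + b" | "\<not> i < m + a" "i < m + a + c" "\<not> j < l + b"
        | "\<not> i < m + a" "\<not> i < m + a + c" "j < l + b" | "\<not> i < m + a" "\<not> i < m + a + c" "\<not> j < l + b" by blast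
      then show ?thesis
      proof cases
        case 1
        then have h: "h i = C" "h j = C" using ij by (auto simp: h_def l_def)
        have "h i * x + h j * y = C * C" unfolding h by (simp add: xy(3) algebra_simps)
        moreover have "C * C > 0" using C by simp
        ultimately show ?thesis using 1 C by (simp add: P_def)
      next
        case 2
        then have h: "h i = C" "h j = -1" using ij by (auto simp: h_def l_def)
        have "h i * x + h j * y = x * x + (x * y - y)" unfolding h xy(3) by (simp add: algebra_simps)
        then show ?thesis using 2 xyp le by (simp add: P_def)
      next
        case 3
        then have h: "h i = -1" "h j = C" using ij by (auto simp: h_def l_def)
        have "h i * x + h j * y = y * y + (x * y - x)" unfolding h xy(3) by (simp add: algebra_simps)
        then show ?thesis using 3 xyp le by (simp add: P_def)
      next
        case 4
        then have "h i = -1" "h j = -1" using ij by (auto simp: h_def l_def)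
        then show ?thesis using 4 xy by (auto simp: P_def)
      next
        case 5
        then have h: "h i = - C\<^sup>2" "h j = C" using ij by (auto simp: h_def l_def)
        have "h i * x + h j * y = - (x * (x * x) + (x * (x * y) - x * y) + x * (x * y) + (x * (y * y) - y * y))"
          unfolding h xy(3) by (simp add: algebra_simps power2_eq_square)
        moreover have "0 < x * (x * y)" using xy by simp
        ultimately show ?thesis using 5 le by (simp add: P_def)
      next
        case 6
        then have h: "h i = - C\<^sup>2" "h j = -1" using ij by (auto simp: h_def l_def)
        have "0 \<le> C\<^sup>2 * x" using xy(1) by (intro mult_nonneg_nonneg) auto
        then have "h i * x + h j * y < 0" using xy(2) unfolding h by linarith
        then show ?thesis using 6 by (simp add: P_def)
      qed
    qed
    then show ?thesis by (simp add: x_def y_def)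
  qed
  have h0: "h i \<noteq> 0" if "m \<le> i" "i < N" for i using C by (auto simp: h_def)
  have "m \<le> l" "l \<le> N" by (simp_all add: l_def N_def)
  then obtain H where H: "\<And>u. strict_at m Q u \<Longrightarrow> strict_at N (outskirts m Q l h H) u \<and>
    card (above_pairs N (outskirts m Q l h H) u) = card (above_pairs m Q u)
      + card {i \<in> {m..<l}. h i > 0} * (m - 1 - u) + card {j \<in> {l..<N}. h j > 0} * u
      + card {(i, j) \<in> {m..<l} \<times> {l..<N}. P i j}"
    using outskirts_above_pairs[of Q m l N h P] Q(2) h0 hP by blast
  have hl: "h i > 0 \<longleftrightarrow> i < m + a" if "i < l" for i using that C by (auto simp: h_def l_def)
  have hr: "h j > 0 \<longleftrightarrow> j < l + b" if "l \<le> j" for j using that C by (auto simp: h_def l_def)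
  have "{i \<in> {m..<l}. h i > 0} = {m..<m + a}" using hl by (auto simp: l_def)
  then have 1: "card {i \<in> {m..<l}. h i > 0} = a" by simp
  have "{j \<in> {l..<N}. h j > 0} = {l..<l + b}" using hr by (auto simp: N_def)
  then have 2: "card {j \<in> {l..<N}. h j > 0} = b" by simp
  have "{(i, j) \<in> {m..<l} \<times> {l..<N}. P i j} = {m..<m + a} \<times> {l..<l + b + d} \<union> {m + a..<m + a + c} \<times> {l..<l + b}"
    (is "_ = ?A \<union> ?B")
    by (auto simp: P_def N_def l_def)
  moreover have "card (?A \<union> ?B) = card ?A + card ?B" by (rule card_Un_disjoint) auto
  ultimately have 3: "card {(i, j) \<in> {m..<l} \<times> {l..<N}. P i j} = a * (b + d) + c * b"
    by (simp only: card_cartesian_product card_atLeastLessThan) simp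
  have "roof_config N (outskirts m Q l h H) D (r + s + a * (b + d) + c * b)"
    unfolding roof_config_def
  proof
    fix u assume u: "u \<in> D"
    then have "strict_at m Q u" "card (above_pairs m Q u) = r" using Q(1) by (auto simp: roof_config_def)
    then show "strict_at N (outskirts m Q l h H) u \<and> card (above_pairs N (outskirts m Q l h H) u) = r + s + a * (b + d) + c * b"
      using H[of u] s[OF u] unfolding 1 2 3 by simp
  qed
  then show ?thesis using that by (simp add: N_def l_def)
qed

section \<open>Assembling the drawings\<close>

text \<open>For \<open>r \<ge> 1\<close> there is room for \<open>q \<ge> 1\<close> complete blocks
  with \<open>q * r\<close> good points, and \<open>m - 1 \<le> q * r + q + r\<close>, where
  \<open>q\<close> and \<open>r\<close> are at most \<open>q * r\<close>.\<close>

lemma exists_roof_config_small: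
  assumes "2 \<le> m" "r \<le> m - 2"
  obtains Q D where "roof_config m Q D r" "\<And>i. Q i $ 1 = real i" "m - 1 \<le> 4 * card D"
proof (cases "r = 0")
  case True
  obtain Q where "roof_config m Q {..<m} 0" "\<And>i. Q i $ 1 = real i" using roof_config_zero[of m] by blast
  then show ?thesis using that[of Q "{..<m}"] True by simp
next
  case False
  then have "r \<ge> 1" by simp
  then obtain Q D where Q: "roof_config m Q D r" "\<And>i. Q i $ 1 = real i" "r * ((m - 1) div (r + 1)) \<le> card D"
    using roof_config_chain[of r m] by blast
  define q where "q = (m - 1) div (r + 1)"
  have "q \<ge> 1" using assms False by (simp add: q_def div_greater_zero_iff Suc_le_eq)
  have "m - 1 = q * (r + 1) + (m - 1) mod (r + 1)"
    unfolding q_def by (simp only: div_mult_mod_eq)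
  moreover have "(m - 1) mod (r + 1) \<le> r" using mod_less_divisor[of "r + 1" "m - 1"] by linarith
  moreover have "1 * r \<le> q * r" "q * 1 \<le> q * r" using \<open>q \<ge> 1\<close> \<open>r \<ge> 1\<close> by (intro mult_le_mono; simp)+
  moreover have "q * (r + 1) = q * r + q" by simp
  ultimately have "m - 1 \<le> 4 * (q * r)" by linarith
  also have "\<dots> \<le> 4 * card D" using Q(3) by (simp add: q_def mult.commute)
  finally show ?thesis using that Q by blast
qed

text \<open>For large \<open>r\<close> half of the points form the core. With \<open>p\<close> high
  points on either side all counts rise by \<open>f p\<close>; taking
  \<open>f p \<le> r < f (p + 1)\<close> leaves a remainder \<open>R < m + 2 * p\<close>.\<close>

lemma exists_roof_config:
  assumes N: "16 \<le> N" and r: "32 * r \<le> N * N"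
  obtains Q D where "roof_config N Q D r" "N \<le> 16 * card D"
proof (cases "r \<le> N - 2")
  case True
  have N2: "2 \<le> N" using N by simp
  obtain Q D where "roof_config N Q D r" "N - 1 \<le> 4 * card D"
    using exists_roof_config_small[OF N2 True] by blast
  then show ?thesis using that[of Q D] N by simp
next
  case False
  define m where "m = N div 2"
  have m: "8 \<le> m" "2 * m \<le> N" "N \<le> 2 * m + 1" using N by (auto simp: m_def)
  have m2: "2 \<le> m" using m(1) by simp
  define f where "f p = p * (m - 1) + p * p" for p
  have "r < f (r + 1)" by (simp add: f_def)
  then obtain p where p: "\<not> r < f p" "r < f (Suc p)"
    using ex_least_nat_less[of "\<lambda>p. r < f p" "r + 1"] by (auto simp: f_def)
  have fS: "f (Suc p) = f p + m + 2 * p" using m by (cases m) (simp_all add: f_def algebra_simps)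
  have p1: "1 \<le> p" using p(2) False m by (cases p) (auto simp: f_def)
  have "32 * r \<le> (2 * m + 1) * (2 * m + 1)" using r mult_le_mono[OF m(3) m(3)] by linarith
  moreover obtain m' where m': "m = m' + 8" using m(1) by (metis le_add_diff_inverse2)
  \<comment> \<open>Together with \<open>f p \<le> r\<close> this bounds \<open>p\<close> by a third
    of \<open>m - 1\<close>, so that the outer points fit into the other half.\<close>
  ultimately have r3: "3 * r \<le> (m - 1) * (m - 1)" by (simp add: m' algebra_simps)
  have "3 * p * (m - 1) \<le> (m - 1) * (m - 1)" using p(1) r3 by (simp add: f_def algebra_simps)
  then have p3: "3 * p \<le> m - 1" using m by simp
  define R where "R = r - f p"
  have rR: "r = f p + R" using p(1) by (simp add: R_def)
  have R: "R < m + 2 * p" using p(2) fS rR by simp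
  \<comment> \<open>The core reaches only \<open>m - 2\<close>. If \<open>R\<close> is larger, three
    more left points, joined above the core with the \<open>p\<close> high right points, take off
    \<open>3 * p\<close>; then \<open>3 * p \<le> m - 1 \<le> R\<close>, and
    \<open>p \<ge> 1\<close> brings the rest down to \<open>m - 2\<close>.\<close>
  define c where "c = (if R \<le> m - 2 then 0 else 3 :: nat)"
  define r0 where "r0 = R - c * p"
  have r0: "r0 \<le> m - 2" "R = r0 + c * p" using R p1 p3 m by (auto simp: r0_def c_def)
  obtain Q D where Q: "roof_config m Q D r0" "\<And>i. Q i $ 1 = real i" "m - 1 \<le> 4 * card D"
    using exists_roof_config_small[OF m2 r0(1)] by blast
  \<comment> \<open>Equally many high points on both sides make the contribution independent of
    \<open>u\<close>.\<close>
  have s: "p * (m - 1 - u) + p * u = p * (m - 1)" if "u \<in> D" for u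
  proof -
    have "u < m" using Q(1) that by (auto simp: roof_config_def strict_at_def)
    then have "m - 1 - u + u = m - 1" by simp
    then show ?thesis by (metis distrib_left)
  qed
  define z where "z = N - (m + p + c + p)"
  have Nz: "m + p + c + z + p + 0 = N" using m p3 by (simp add: z_def c_def)
  have rz: "r0 + p * (m - 1) + p * (p + 0) + c * p = r" using rR r0(2) by (simp add: f_def)
  obtain Q' where "roof_config N Q' D r"
    using roof_config_extend[OF Q(1,2) s, of c z 0] unfolding Nz rz by blast
  then show ?thesis using that[of Q' D] Q(3) m by simp
qed

text \<open>For bounded \<open>n\<close> one edge is enough, but every \<open>k\<close> must occur.
  Around a one-point core, \<open>a\<close> left points are joined above it with all
  \<open>\<rho>\<close> right points and, if \<open>b > 0\<close>, one more with \<open>b\<close> of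
  them.\<close>

lemma exists_roof_config_single:
  assumes k: "4 * k \<le> (n - 2) * (n - 2)" and n: "2 \<le> n"
  obtains Q where "roof_config (n - 1) Q {..<1} k"
proof -
  \<comment> \<open>The balanced split, for which \<open>l * \<rho>\<close> is the integer part of a
    quarter of \<open>(n - 2)\<^sup>2\<close>.\<close>
  define l \<rho> where "l = (n - 2) div 2" and "\<rho> = n - 2 - l"
  have n2: "n - 2 = l + \<rho>" and cases: "\<rho> = l \<or> \<rho> = l + 1" unfolding \<rho>_def l_def by linarith+
  have kle: "k \<le> l * \<rho>" using k cases unfolding n2 by (auto simp: algebra_simps)
  define a b d c z where "a = k div \<rho>" and "b = k mod \<rho>" and "d = \<rho> - b"
    and "c = (if b = 0 then 0 else 1 :: nat)" and "z = l - (a + c)"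
  have kab: "k = a * \<rho> + b" by (simp add: a_def b_def)
  \<comment> \<open>If \<open>\<rho> = 0\<close> then \<open>k = 0\<close>, and division by zero
    gives \<open>a = b = 0\<close> as desired.\<close>
  have ac: "a + c \<le> l"
  proof (cases "\<rho> = 0")
    case True
    then show ?thesis using kle by (simp add: a_def b_def c_def)
  next
    case False
    have "a \<le> l" using div_le_mono[OF kle, of \<rho>] False by (simp add: a_def)
    moreover have "a \<noteq> l" if "b \<noteq> 0" using kle kab that by auto
    ultimately show ?thesis by (auto simp: c_def)
  qed
  have bd: "b + d = \<rho>"
  proof (cases "\<rho> = 0")
    case False
    then have "b < \<rho>" by (simp add: b_def)
    then show ?thesis by (simp add: d_def)
  qed (use kle in \<open>simp add: b_def d_def\<close>)
  obtain Q where Q: "roof_config 1 Q {..<1} 0" "\<And>i. Q i $ 1 = real i" using roof_config_zero[of 1] by blast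
  have s: "a * (1 - 1 - u) + b * u = 0" if "u \<in> {..<1}" for u using that by simp
  have Nz: "1 + a + c + z + b + d = n - 1" using ac bd n2 n by (simp add: z_def)
  have kz: "0 + 0 + a * (b + d) + c * b = k" unfolding bd kab by (simp add: c_def)
  obtain Q' where "roof_config (n - 1) Q' {..<1} k"
    using roof_config_extend[OF Q s, of c z d] unfolding Nz kz by blast
  then show ?thesis using that by blast
qed

section \<open>From configurations to drawings\<close>

lemma tower_drawing:
  assumes D: "\<And>u. u \<in> D \<Longrightarrow> strict_at N Q u" "\<And>u. u \<in> D \<Longrightarrow> j u < M"
    "\<And>u. u \<in> D \<Longrightarrow> (card (left_of N Q u) + j u) * (card (right_of N Q u) + (M - 1 - j u)) = k + card (below_pairs N Q u)"
  obtains p where "rectilinear_drawing {..<N + M} (complete_edges {..<N + M}) p"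
    "card D \<le> e_count k (complete_edges {..<N + M}) p"
proof -
  obtain R where R: "\<And>u j. strict_at N Q u \<Longrightarrow> j < M \<Longrightarrow> strict_edge {..<N + M} (tower N Q R) u (N + j) \<and>
     card (crossing_pairs {..<N + M} (tower N Q R) u (N + j)) + card (below_pairs N Q u) =
     (card (left_of N Q u) + j) * (card (right_of N Q u) + (M - 1 - j))"
    using tower_crossings[of N Q M] by blast
  let ?e = "\<lambda>u. {u, N + j u}"
  have uN: "u < N" if "u \<in> D" for u using D(1)[OF that] by (simp add: strict_at_def)
  \<comment> \<open>Several \<open>u\<close> may use the same cap vertex; their edges differ because
    \<open>u\<close> is the only end below \<open>N\<close>.\<close>
  have "inj_on ?e D"
    by (rule inj_onI) (use uN in \<open>fastforce simp: doubleton_eq_iff\<close>)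
  then have card: "card (?e ` D) = card D" by (rule card_image)
  have "\<exists>p. rectilinear_drawing {..<N + M} (complete_edges {..<N + M}) p \<and>
    card (?e ` D) \<le> e_count k (complete_edges {..<N + M}) p"
  proof (rule exists_drawing_e_count)
    fix e assume "e \<in> ?e ` D"
    then obtain u where u: "u \<in> D" "e = ?e u" by blast
    show "\<exists>u\<in>{..<N + M}. \<exists>v\<in>{..<N + M}. u \<noteq> v \<and> e = {u, v} \<and> strict_edge {..<N + M} (tower N Q R) u v \<and>
      card (crossing_pairs {..<N + M} (tower N Q R) u v) = k"
      using R[OF D(1,2)[OF u(1)]] D(2,3)[OF u(1)] uN[OF u(1)] u(2)
      by (intro bexI[of _ u] bexI[of _ "N + j u"]) auto
  qed simp
  then show ?thesis using that card by auto
qed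

text \<open>With a single cap vertex, all left-right pairs minus those below \<open>u\<close> leave
  the pairs above \<open>u\<close>.\<close>

lemma star_drawing:
  assumes "roof_config N Q D k"
  obtains p where "rectilinear_drawing {..<N + 1} (complete_edges {..<N + 1}) p"
    "card D \<le> e_count k (complete_edges {..<N + 1}) p"
proof (rule tower_drawing[of D N Q "\<lambda>_. 0" 1 k])
  fix u assume "u \<in> D"
  then have u: "strict_at N Q u" "card (above_pairs N Q u) = k" using assms by (auto simp: roof_config_def)
  then show "strict_at N Q u" by simp
  show "(card (left_of N Q u) + 0) * (card (right_of N Q u) + (1 - 1 - 0)) = k + card (below_pairs N Q u)"
    using card_above_below[OF u(1)] u(2) by simp
qed (use that in auto)

text \<open>A reflection puts the \<open>r\<close> segments below \<open>u\<close>, where they are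
  subtracted from \<open>\<alpha> * \<beta>\<close>. As \<open>N\<close> is at most
  \<open>\<alpha>\<close> and \<open>\<beta>\<close>, some cap vertex tops up the left side of
  \<open>u\<close> to \<open>\<alpha>\<close> and the right side to \<open>\<beta>\<close>.\<close>

lemma cap_drawing:
  assumes Q: "roof_config N Q D r" and "N \<le> \<alpha>" "N \<le> \<beta>" and n: "\<alpha> + \<beta> + 2 = N + M" and k: "\<alpha> * \<beta> = k + r"
  obtains p where "rectilinear_drawing {..<N + M} (complete_edges {..<N + M}) p"
    "card D \<le> e_count k (complete_edges {..<N + M}) p"
proof -
  define Q' :: "nat \<Rightarrow> real ^ 2" where "Q' i = vector [Q i $ 1, - Q i $ 2]" for i
  have lr: "left_of N Q' u = left_of N Q u" "right_of N Q' u = right_of N Q u" for u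
    by (simp_all add: left_of_def right_of_def Q'_def)
  have o: "orient (Q' a) (Q' b) (Q' c) = - orient (Q a) (Q b) (Q c)" for a b c
    by (simp add: orient_def Q'_def algebra_simps)
  have ba: "below_pairs N Q' u = above_pairs N Q u" for u
    by (simp add: below_pairs_def above_pairs_def lr o)
  have st: "strict_at N Q' u \<longleftrightarrow> strict_at N Q u" for u
    unfolding strict_at_def lr o by (simp add: Q'_def)
  show ?thesis
  proof (rule tower_drawing[of D N Q' "\<lambda>u. \<alpha> - card (left_of N Q u)" M k])
    fix u assume "u \<in> D"
    then have u: "strict_at N Q u" "card (above_pairs N Q u) = r" using Q by (auto simp: roof_config_def)
    then show "strict_at N Q' u" using st by simp
    note c = card_left_right[OF u(1)]
    have N: "0 < N" using u(1) by (simp add: strict_at_def)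
    then show "\<alpha> - card (left_of N Q u) < M" using c assms(2-4) by linarith
    have "card (left_of N Q u) + (\<alpha> - card (left_of N Q u)) = \<alpha>"
      "card (right_of N Q u) + (M - 1 - (\<alpha> - card (left_of N Q u))) = \<beta>"
      using c N assms(2-4) by linarith+
    then show "(card (left_of N Q' u) + (\<alpha> - card (left_of N Q u))) *
      (card (right_of N Q' u) + (M - 1 - (\<alpha> - card (left_of N Q u)))) = k + card (below_pairs N Q' u)"
      using k u(2) by (simp only: lr ba)
  qed (use that in blast)
qed

text \<open>Take \<open>\<alpha>\<close> at the first step where
  \<open>\<alpha> * (n - 2 - \<alpha>)\<close> reaches \<open>k\<close>. The step before gave
  \<open>(\<alpha> - 1) * (\<beta> + 1) < k\<close>, so the excess is less than
  \<open>\<beta> - \<alpha> + 1\<close>.\<close>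

lemma exists_balanced_product:
  fixes k n :: nat
  assumes k: "0 < k" "4 * k \<le> (n - 2) * (n - 2)"
  obtains \<alpha> \<beta> r where "\<alpha> \<le> \<beta>" "\<alpha> + \<beta> = n - 2" "\<alpha> * \<beta> = k + r" "r \<le> n"
proof -
  define l where "l = (n - 2) div 2"
  have cases: "n - 2 = l + l \<or> n - 2 = l + (l + 1)" unfolding l_def by linarith
  then have "k \<le> l * (n - 2 - l)"
  proof
    assume e: "n - 2 = l + l"
    show ?thesis using k(2) unfolding e by (simp add: algebra_simps)
  next
    assume e: "n - 2 = l + (l + 1)"
    show ?thesis using k(2) unfolding e by (simp add: algebra_simps)
  qed
  then obtain i where i: "i < l" "\<not> k \<le> i * (n - 2 - i)" "k \<le> Suc i * (n - 2 - Suc i)"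
    using ex_least_nat_less[of "\<lambda>i. k \<le> i * (n - 2 - i)" l] k(1) by auto
  define \<beta> where "\<beta> = n - 2 - Suc i"
  have "n - 2 - i = \<beta> + 1" using i(1) cases by (auto simp: \<beta>_def)
  then have "i * (\<beta> + 1) < k" using i(2) by simp
  moreover have "k \<le> Suc i * \<beta>" using i(3) by (simp add: \<beta>_def)
  ultimately have "Suc i * \<beta> = k + (Suc i * \<beta> - k)" "Suc i * \<beta> - k \<le> n" by (auto simp: \<beta>_def)
  moreover have "Suc i \<le> \<beta>" "Suc i + \<beta> = n - 2" using i(1) cases by (auto simp: \<beta>_def)
  ultimately show ?thesis using that by blast
qed

lemma exists_drawing:
  assumes n: "2 \<le> n" and k: "4 * k \<le> (n - 2) * (n - 2)"
  obtains p where "rectilinear_drawing {..<n} (complete_edges {..<n}) p"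
    "n \<le> 65536 * e_count k (complete_edges {..<n}) p"
proof -
  have n1: "n - 1 + 1 = n" using n by simp
  consider "n < 65536" | "65536 \<le> n" "32 * k \<le> (n - 1) * (n - 1)"
    | "65536 \<le> n" "(n - 1) * (n - 1) < 32 * k" by (meson not_le)
  then show ?thesis
  proof cases
    case 1
    \<comment> \<open>Below 65536 vertices a single edge with \<open>k\<close> crossings meets the
      bound.\<close>
    obtain Q where "roof_config (n - 1) Q {..<1} k" using exists_roof_config_single[OF k n] .
    from star_drawing[OF this] obtain p where p: "rectilinear_drawing {..<n} (complete_edges {..<n}) p"
      "card {..<1 :: nat} \<le> e_count k (complete_edges {..<n}) p" unfolding n1 by blast
    from p(2) 1 have "n \<le> 65536 * e_count k (complete_edges {..<n}) p" by simp
    then show ?thesis using that p(1) by blast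
  next
    case 2
    have n16: "16 \<le> n - 1" using 2(1) by simp
    obtain Q D where Q: "roof_config (n - 1) Q D k" "n - 1 \<le> 16 * card D"
      using exists_roof_config[OF n16 2(2)] by blast
    from star_drawing[OF Q(1)] obtain p where p: "rectilinear_drawing {..<n} (complete_edges {..<n}) p"
      "card D \<le> e_count k (complete_edges {..<n}) p" unfolding n1 by blast
    have "n \<le> 65536 * e_count k (complete_edges {..<n}) p" using p(2) Q(2) 2(1) by linarith
    then show ?thesis using that p(1) by blast
  next
    case 3
    \<comment> \<open>Small enough for \<open>N \<le> \<alpha>\<close>, which follows from
      \<open>\<alpha> * \<beta> > (n - 1)\<^sup>2 / 32\<close>. The threshold 65536 gives
      \<open>N \<ge> 2047\<close>, large enough that \<open>r \<le> n\<close> implies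
      \<open>32 * r \<le> N * N\<close>.\<close>
    define N where "N = (n - 1) div 32"
    have N: "2047 \<le> N" "32 * N \<le> n - 1" "n \<le> 32 * N + 32" using 3(1) by (auto simp: N_def)
    have "0 < k" using 3(2) by (cases k) auto
    then obtain \<alpha> \<beta> r where ab: "\<alpha> \<le> \<beta>" "\<alpha> + \<beta> = n - 2" "\<alpha> * \<beta> = k + r" "r \<le> n"
      using exists_balanced_product[OF _ k] by blast
    have "(n - 1) * (n - 1) < 32 * (\<alpha> * \<beta>)" using 3(2) ab(3) by simp
    also have "\<dots> \<le> 32 * (\<alpha> * (n - 1))" using ab(2) by (intro mult_le_mono) auto
    finally have "(n - 1) * (n - 1) < (32 * \<alpha>) * (n - 1)" by simp
    then have "n - 1 < 32 * \<alpha>" by simp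
    then have N\<alpha>: "N \<le> \<alpha>" using N(2) by linarith
    have "2047 * N \<le> N * N" using N(1) by (rule mult_le_mono1)
    then have "32 * r \<le> N * N" using ab(4) N by linarith
    moreover have "16 \<le> N" using N(1) by simp
    ultimately obtain Q D where Q: "roof_config N Q D r" "N \<le> 16 * card D"
      using exists_roof_config[of N r] by blast
    have NM: "N + (n - N) = n" using N(2) by linarith
    have "\<alpha> + \<beta> + 2 = N + (n - N)" using ab(2) n NM by linarith
    from cap_drawing[OF Q(1) N\<alpha> order_trans[OF N\<alpha> ab(1)] this ab(3)] obtain p
      where p: "rectilinear_drawing {..<n} (complete_edges {..<n}) p" "card D \<le> e_count k (complete_edges {..<n}) p"
      unfolding NM by blast
    have "n \<le> 65536 * e_count k (complete_edges {..<n}) p" using p(2) Q(2) N by linarith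
    then show ?thesis using that p(1) by blast
  qed
qed

theorem theorem3p1:
  "\<exists>c::real. c > 0 \<and>
     (\<forall>n k :: nat. n \<ge> 2 \<and> int k \<le> \<lfloor>(real n - 2)\<^sup>2 / 4\<rfloor> \<longrightarrow>
        real (max_e k {..<n} (complete_edges {..<n})) \<ge> c * real n \<and>
        (\<exists>p. rectilinear_drawing {..<n} (complete_edges {..<n}) p \<and>
             real (e_count k (complete_edges {..<n}) p) \<ge> c * real n))"
proof (intro exI[of _ "1 / 65536"] conjI allI impI)
  fix n k :: nat assume nk: "n \<ge> 2 \<and> int k \<le> \<lfloor>(real n - 2)\<^sup>2 / 4\<rfloor>"
  then have "real k \<le> (real n - 2)\<^sup>2 / 4" by (simp add: le_floor_iff)
  also have "real n - 2 = real (n - 2)" using nk by simp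
  finally have "real (4 * k) \<le> real ((n - 2) * (n - 2))" by (simp add: power2_eq_square)
  then have "4 * k \<le> (n - 2) * (n - 2)" unfolding of_nat_le_iff .
  then obtain p where p: "rectilinear_drawing {..<n} (complete_edges {..<n}) p"
    "n \<le> 65536 * e_count k (complete_edges {..<n}) p" using exists_drawing nk by blast
  have "real n \<le> real (65536 * e_count k (complete_edges {..<n}) p)" using p(2) of_nat_le_iff by blast
  then have e: "1 / 65536 * real n \<le> real (e_count k (complete_edges {..<n}) p)" by simp
  have "e_count k (complete_edges {..<n}) p \<le> max_e k {..<n} (complete_edges {..<n})"
    by (rule max_e_ge[OF simple_graph_complete p(1)]) simp
  then show "1 / 65536 * real n \<le> real (max_e k {..<n} (complete_edges {..<n}))" using e by linarith
  show "\<exists>p. rectilinear_drawing {..<n} (complete_edges {..<n}) p \<and>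
    1 / 65536 * real n \<le> real (e_count k (complete_edges {..<n}) p)" using p(1) e by blast
qed simp

end
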